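(* Let $C_1,\dots,C_T\in\mathbb{R}^{n\times n}$ be symmetric with $0\preceq C_t\preceq I$, $T\ge1$, and let $\mathscr{B}^n_1$ be the set of density matrices (symmetric positive semidefinite with trace $1$). Run the following algorithm: start from $Y_1\in\mathscr{B}^n_1$; at each $t$ eigendecompose $Y_t=\widehat D\mathrm{diag}(\sigma_t)\widehat D^\top$, play the unit vector $y_t=\widehat D[:,j]$ with probability $\sigma_{t,j}$ (expected loss $\mathrm{Tr}(Y_tC_t)$), receive $C_t$, and update $$V_{t+1}=\frac{\exp(\ln Y_t-\eta C_t)}{\mathrm{Tr}\exp(\ln Y_t-\eta C_t)}=\widehat U\mathrm{diag}(v_{t+1})\widehat U^\top,\qquad Y_{t+1}=\widehat U\mathrm{diag}\Big(\frac\alpha n+(1-\alpha)v_{t+1}\Big)\widehat U^\top.$$ Suppose $L>0$ satisfies $\min_{U\in\mathscr{B}^n_1}\sum_{t=r}^s\mathrm{Tr}(UC_t)\le L$ for all $1\le r\le s\le T$, and set $\alpha=\frac1{T+1}$, $D=\ln(n(1+T))+1$, $\eta=\ln(1+\sqrt{2D/L})$. Then $$\mathcal{R}_a^{\mathrm{var\text{-}unit}}:=\max_{[r,s]\subset[1,T]}\Big\{\sum_{t=r}^s\mathrm{Tr}(Y_tC_t)-\min_{U\in\mathscr{B}^n_1}\sum_{t=r}^s\mathrm{Tr}(UC_t)\Big\}\le O(\sqrt{2LD}+D).$$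
   Context: $\ln,\exp$ denote matrix logarithm/exponential. $O(\cdot)$ hides an absolute constant.
   Formalization: The starting matrix Y_1 is assumed positive definite, since ln Y_1 is undefined for a singular density matrix; the random play of eigenvectors is not modelled, and regret is stated directly with the expected loss Tr(Y_t C_t). *)

theory Defs
  imports Complex_Main "Jordan_Normal_Form.Matrix"
begin

definition mtrace :: "real mat \<Rightarrow> real" where
  "mtrace A = (\<Sum>i<dim_row A. A $$ (i, i))"

definition sym_mat :: "nat \<Rightarrow> real mat \<Rightarrow> bool" where
  "sym_mat n A \<longleftrightarrow> A \<in> carrier_mat n n \<and> transpose_mat A = A"

definition psd_mat :: "nat \<Rightarrow> real mat \<Rightarrow> bool" where
  "psd_mat n A \<longleftrightarrow> sym_mat n A \<and> (\<forall>v \<in> carrier_vec n. v \<bullet> (A *\<^sub>v v) \<ge> 0)"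

definition pd_mat :: "nat \<Rightarrow> real mat \<Rightarrow> bool" where
  "pd_mat n A \<longleftrightarrow> sym_mat n A \<and> (\<forall>v \<in> carrier_vec n. v \<noteq> 0\<^sub>v n \<longrightarrow> v \<bullet> (A *\<^sub>v v) > 0)"

definition density_mats :: "nat \<Rightarrow> real mat set" where
  "density_mats n = {U. psd_mat n U \<and> mtrace U = 1}"

definition orthonormal_mat :: "nat \<Rightarrow> real mat \<Rightarrow> bool" where
  "orthonormal_mat n P \<longleftrightarrow> P \<in> carrier_mat n n \<and> transpose_mat P * P = 1\<^sub>m n"

definition mat_fun :: "nat \<Rightarrow> (real \<Rightarrow> real) \<Rightarrow> real mat \<Rightarrow> real mat" where
  "mat_fun n f A =
     (let p = (SOME p. orthonormal_mat n (fst p) \<and>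
                       A = fst p * mat_diag n (snd p) * transpose_mat (fst p))
      in fst p * mat_diag n (\<lambda>j. f (snd p j)) * transpose_mat (fst p))"

definition mexp :: "nat \<Rightarrow> real mat \<Rightarrow> real mat" where
  "mexp n A = mat_fun n exp A"

definition mln :: "nat \<Rightarrow> real mat \<Rightarrow> real mat" where
  "mln n A = mat_fun n ln A"

end

theory Submission
  imports Defs "Jordan_Normal_Form.Spectral_Radius"
begin

text \<open>
  The potential is \<open>Tr (U ln Y\<^sub>t)\<close> for a fixed comparator \<open>U\<close>. One exponentiated step changes it by
  \<open>- \<eta> Tr (U C\<^sub>t) - ln Z\<close> with \<open>Z = Tr exp (ln Y\<^sub>t - \<eta> C\<^sub>t)\<close>, and the mixing step costs at most
  \<open>- ln (1 - \<alpha>)\<close> while keeping all eigenvalues of \<open>Y\<^sub>t\<close> above \<open>\<alpha> / n\<close>; hence the sum telescopes on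
  every interval that does not contain \<open>t = 1\<close>, and the first step itself costs at most 1.

  The bound on \<open>Z\<close> usually comes from the Golden--Thompson inequality. Up to constants two inequalities
  of Klein type suffice, for symmetric \<open>A\<close>, \<open>B\<close> and \<open>D = A - B\<close>: \<open>Tr exp A - Tr exp B \<le> Tr (exp A D)\<close>
  and \<open>Tr ((exp A - exp B) D) \<le> Tr ((exp A + exp B) D\<^sup>2) / 2\<close>. Both follow entrywise from scalar
  inequalities once the traces are expanded in the eigenbases of \<open>A\<close> and \<open>B\<close>. With \<open>A = ln Y\<close> and
  \<open>D = \<eta> C\<close> the second one compares \<open>Tr (exp (ln Y - \<eta> C) C)\<close> with \<open>Tr (Y C)\<close>, and the first one then
  bounds the decrease of the trace.
\<close>

section \<open>Orthogonal diagonalisation of real symmetric matrices\<close>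

text \<open>The same expression stands under \<open>SOME\<close> in \<open>mat_fun\<close> and in
  the update rule, so both fold into it. Orthonormality of \<open>P\<close> is left to the
  individual lemmas.\<close>

definition spectral_mat :: "nat \<Rightarrow> real mat \<Rightarrow> (nat \<Rightarrow> real) \<Rightarrow> real mat" where
  "spectral_mat n P a = P * mat_diag n a * transpose_mat P"

lemma orthonormal_matD:
  assumes "orthonormal_mat n P"
  shows "P \<in> carrier_mat n n" "transpose_mat P * P = 1\<^sub>m n" "P * transpose_mat P = 1\<^sub>m n"
  using assms mat_mult_left_right_inverse[of "transpose_mat P" n P]
  unfolding orthonormal_mat_def by auto

lemma spectral_mat_carrier [simp]: "P \<in> carrier_mat n n \<Longrightarrow> spectral_mat n P a \<in> carrier_mat n n"
  unfolding spectral_mat_def by (metis mat_diag_dim mult_carrier_mat transpose_carrier_mat)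

lemma mult_square_mat_carrier [simp]:
  "A \<in> carrier_mat n n \<Longrightarrow> B \<in> carrier_mat n n \<Longrightarrow> A * B \<in> carrier_mat n n"
  by (rule mult_carrier_mat)

lemma spectral_mat_dim [simp]:
  assumes "P \<in> carrier_mat n n"
  shows "dim_row (spectral_mat n P a) = n" "dim_col (spectral_mat n P a) = n"
  using spectral_mat_carrier[OF assms, of a] by auto

lemma spectral_mat_index:
  assumes "P \<in> carrier_mat n n" "i < n" "j < n"
  shows "spectral_mat n P a $$ (i, j) = (\<Sum>k<n. P $$ (i, k) * a k * P $$ (j, k))"
  using assms unfolding spectral_mat_def
  by (simp add: mat_diag_mult_right[of P n n] scalar_prod_def lessThan_atLeast0)

text \<open>The complex spectrum of a matrix of positive size is nonempty. Symmetry forces the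
  eigenvalue \<open>z\<close> found there to be real; then the real and imaginary parts of its
  eigenvector both satisfy the real eigenvalue equation, and at least one of them is
  nonzero.\<close>

lemma real_symmetric_eigenvector:
  assumes A: "sym_mat n A" and n: "n > 0"
  obtains v k where "v \<in> carrier_vec n" "v \<bullet> v = 1" "A *\<^sub>v v = k \<cdot>\<^sub>v v"
proof -
  have Ac: "A \<in> carrier_mat n n" using A by (simp add: sym_mat_def)
  let ?A = "map_mat complex_of_real A"
  have "spectrum ?A \<noteq> {}" using spectrum_non_empty[of ?A n] Ac n by auto
  then obtain u z where u: "u \<in> carrier_vec n" "u \<noteq> 0\<^sub>v n" "?A *\<^sub>v u = z \<cdot>\<^sub>v u"
    using Ac unfolding spectrum_def eigenvalue_def eigenvector_def by auto
  define x where "x = map_vec Re u"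
  define y where "y = map_vec Im u"
  have xy: "x \<in> carrier_vec n" "y \<in> carrier_vec n" using u(1) by (auto simp: x_def y_def)
  have eq: "(\<Sum>j<n. complex_of_real (A $$ (i, j)) * u $ j) = z * u $ i" if "i < n" for i
  proof -
    have "(?A *\<^sub>v u) $ i = (z \<cdot>\<^sub>v u) $ i" by (simp add: u(3))
    then show ?thesis using that Ac u(1) by (simp add: scalar_prod_def lessThan_atLeast0)
  qed
  have Ax: "A *\<^sub>v x = Re z \<cdot>\<^sub>v x - Im z \<cdot>\<^sub>v y"
  proof (rule eq_vecI)
    fix i assume "i < dim_vec (Re z \<cdot>\<^sub>v x - Im z \<cdot>\<^sub>v y)"
    then have i: "i < n" using xy by simp
    show "(A *\<^sub>v x) $ i = (Re z \<cdot>\<^sub>v x - Im z \<cdot>\<^sub>v y) $ i"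
      using arg_cong[OF eq[OF i], of Re] i Ac u(1)
      by (simp add: scalar_prod_def lessThan_atLeast0 x_def y_def)
  qed (use xy Ac in auto)
  have Ay: "A *\<^sub>v y = Re z \<cdot>\<^sub>v y + Im z \<cdot>\<^sub>v x"
  proof (rule eq_vecI)
    fix i assume "i < dim_vec (Re z \<cdot>\<^sub>v y + Im z \<cdot>\<^sub>v x)"
    then have i: "i < n" using xy by simp
    show "(A *\<^sub>v y) $ i = (Re z \<cdot>\<^sub>v y + Im z \<cdot>\<^sub>v x) $ i"
      using arg_cong[OF eq[OF i], of Im] i Ac u(1)
      by (simp add: scalar_prod_def lessThan_atLeast0 x_def y_def)
  qed (use xy Ac in auto)
  \<comment> \<open>In the two expansions the terms with \<open>Re z\<close> agree, so what remains
    is \<open>Im z\<close> times the squared length of the complex eigenvector.\<close>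
  have "x \<bullet> (A *\<^sub>v y) = (A *\<^sub>v x) \<bullet> y"
    using transpose_vec_mult_scalar[OF Ac xy(2) xy(1)] A by (simp add: sym_mat_def)
  then have "Im z * (x \<bullet> x + y \<bullet> y) = 0"
    unfolding Ax Ay using xy comm_scalar_prod[OF xy]
    by (simp add: scalar_prod_add_distrib[of _ n] minus_scalar_prod_distrib[of _ n] algebra_simps)
  moreover have nz: "x \<bullet> x + y \<bullet> y \<noteq> 0"
  proof
    assume "x \<bullet> x + y \<bullet> y = 0"
    then have s: "(\<Sum>i<n. (x $ i)\<^sup>2 + (y $ i)\<^sup>2) = 0"
      using xy by (simp add: scalar_prod_def power2_eq_square sum.distrib lessThan_atLeast0)
    have "(x $ i)\<^sup>2 + (y $ i)\<^sup>2 = 0" if "i < n" for i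
      using s that by (subst (asm) sum_nonneg_eq_0_iff) auto
    then have "u $ i = 0" if "i < n" for i
      using that u(1) by (auto simp: x_def y_def complex_eq_iff sum_power2_eq_zero_iff)
    then have "u = 0\<^sub>v n" using u(1) by (intro eq_vecI) auto
    with u(2) show False by simp
  qed
  ultimately have im: "Im z = 0" by simp
  have ex: "\<exists>w. w \<in> carrier_vec n \<and> w \<bullet> w \<noteq> 0 \<and> A *\<^sub>v w = Re z \<cdot>\<^sub>v w"
  proof (cases "x \<bullet> x = 0")
    case True
    then have "y \<bullet> y \<noteq> 0" using nz by simp
    moreover have "A *\<^sub>v y = Re z \<cdot>\<^sub>v y" unfolding Ay im using xy by (intro eq_vecI) auto
    ultimately show ?thesis using xy by blast
  next
    case False
    moreover have "A *\<^sub>v x = Re z \<cdot>\<^sub>v x" unfolding Ax im using xy by (intro eq_vecI) auto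
    ultimately show ?thesis using xy by blast
  qed
  then obtain w where w: "w \<in> carrier_vec n" "w \<bullet> w \<noteq> 0" "A *\<^sub>v w = Re z \<cdot>\<^sub>v w" by blast
  have "w \<bullet> w \<ge> 0" by (simp add: scalar_prod_def sum_nonneg)
  then have pos: "w \<bullet> w > 0" using w(2) by simp
  define c where "c = 1 / sqrt (w \<bullet> w)"
  show ?thesis
  proof
    show "c \<cdot>\<^sub>v w \<in> carrier_vec n" using w by simp
    show "(c \<cdot>\<^sub>v w) \<bullet> (c \<cdot>\<^sub>v w) = 1" using w pos by (simp add: c_def)
    show "A *\<^sub>v (c \<cdot>\<^sub>v w) = Re z \<cdot>\<^sub>v (c \<cdot>\<^sub>v w)"
      using w Ac by (simp add: mult_mat_vec smult_smult_assoc mult.commute)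
  qed
qed

text \<open>A single reflection completes \<open>v\<close> to an orthonormal basis. It is taken
  along \<open>v - e\<close> with \<open>e\<close> the first unit vector, so the case
  \<open>v = e\<close> is treated apart with the identity.\<close>

lemma orthonormal_mat_first_col:
  assumes v: "v \<in> carrier_vec n" "v \<bullet> v = 1" and n: "n > 0"
  obtains H where "orthonormal_mat n H" "col H 0 = v"
proof (cases "v = unit_vec n 0")
  case True
  show ?thesis by (rule that[of "1\<^sub>m n"]) (use True n in \<open>auto simp: orthonormal_mat_def\<close>)
next
  case False
  define e :: "real vec" where "e = unit_vec n 0"
  define w where "w = v - e"
  define s where "s = w \<bullet> w"
  have wc: "w \<in> carrier_vec n" using v by (simp add: w_def e_def)
  have s_eq: "s = 2 - 2 * v $ 0"
    unfolding s_def w_def using v n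
    by (simp add: minus_scalar_prod_distrib[of _ n] scalar_prod_minus_distrib[of _ n] e_def)
  have s_sum: "s = (\<Sum>k<n. w $ k * w $ k)"
    using wc by (simp add: s_def scalar_prod_def lessThan_atLeast0)
  have s0: "s \<noteq> 0"
  proof
    assume "s = 0"
    then have "(\<Sum>k<n. w $ k * w $ k) = 0" using s_sum by simp
    then have "w $ k = 0" if "k < n" for k
      using that by (subst (asm) sum_nonneg_eq_0_iff) auto
    then have "v = e" using v by (intro eq_vecI) (auto simp: w_def e_def)
    with False show False by (simp add: e_def)
  qed
  \<comment> \<open>the Householder reflection exchanging \<open>e\<close> and \<open>v\<close>\<close>
  define H where "H = mat n n (\<lambda>(i, j). (if i = j then 1 else 0) - 2 * w $ i * w $ j / s)"
  have Hc: "H \<in> carrier_mat n n" by (simp add: H_def)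
  have "transpose_mat H * H = 1\<^sub>m n"
  proof (rule eq_matI)
    fix i j assume "i < dim_row (1\<^sub>m n :: real mat)" "j < dim_col (1\<^sub>m n :: real mat)"
    then have ij: "i < n" "j < n" by auto
    define c where "c = 4 * w $ i * w $ j / s^2"
    have "(transpose_mat H * H) $$ (i, j) =
      (\<Sum>k<n. ((if k = i then 1 else 0) - 2 * w $ k * w $ i / s) * ((if k = j then 1 else 0) - 2 * w $ k * w $ j / s))"
      using ij by (simp add: H_def scalar_prod_def lessThan_atLeast0)
    also have "\<dots> = (\<Sum>k<n. (if k = i then if k = j then 1 else 0 else 0)
        - (if k = i then 2 * w $ k * w $ j / s else 0) - (if k = j then 2 * w $ k * w $ i / s else 0)
        + c * (w $ k * w $ k))"
      by (rule sum.cong) (auto simp: c_def algebra_simps power2_eq_square)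
    also have "\<dots> = (if i = j then 1 else 0) - 4 * w $ i * w $ j / s + c * s"
      using ij by (simp add: sum.distrib sum_subtractf sum_distrib_left[symmetric] s_sum[symmetric])
    also have "\<dots> = (1\<^sub>m n :: real mat) $$ (i, j)"
      using ij s0 by (simp add: c_def power2_eq_square)
    finally show "(transpose_mat H * H) $$ (i, j) = (1\<^sub>m n :: real mat) $$ (i, j)" .
  qed (use Hc in auto)
  moreover have "col H 0 = v"
  proof (rule eq_vecI)
    fix i assume "i < dim_vec v"
    then have i: "i < n" using v by simp
    \<comment> \<open>Since \<open>v\<close> has length 1,
      \<open>w $ 0 = v $ 0 - 1 = - s / 2\<close>; the factor \<open>2 * w $ 0 / s\<close> is then
      \<open>-1\<close>, and the first column becomes \<open>e + w = v\<close>.\<close>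
    have w0: "w $ 0 = - s / 2" using v n by (simp add: w_def e_def s_eq)
    have "col H 0 $ i = (if i = 0 then 1 else 0) + w $ i"
      using i n s0 by (simp add: H_def w0)
    then show "col H 0 $ i = v $ i"
      using i n v by (simp add: w_def e_def)
  qed (use v Hc in auto)
  ultimately show ?thesis using Hc that by (auto simp: orthonormal_mat_def)
qed

text \<open>Deflation: in an orthonormal basis that starts with an eigenvector the matrix splits
  into a 1 by 1 block and a symmetric block of size \<open>n\<close>, to which the induction
  hypothesis applies.\<close>

lemma spectral_theorem:
  assumes "sym_mat n A"
  shows "\<exists>P a. orthonormal_mat n P \<and> A = spectral_mat n P a"
  using assms
proof (induction n arbitrary: A)
  case 0
  then have "A = spectral_mat 0 (1\<^sub>m 0) (\<lambda>_. 0)" by (intro eq_matI) (auto simp: sym_mat_def spectral_mat_def)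
  moreover have "orthonormal_mat 0 (1\<^sub>m 0)" by (auto simp: orthonormal_mat_def)
  ultimately show ?case by blast
next
  case (Suc n)
  let ?N = "Suc n"
  have A: "A \<in> carrier_mat ?N ?N" "transpose_mat A = A" using Suc.prems by (auto simp: sym_mat_def)
  obtain v k where v: "v \<in> carrier_vec ?N" "v \<bullet> v = 1" "A *\<^sub>v v = k \<cdot>\<^sub>v v"
    using real_symmetric_eigenvector[OF Suc.prems] by auto
  obtain H where H: "orthonormal_mat ?N H" and Hv: "col H 0 = v"
    using orthonormal_mat_first_col[OF v(1,2)] by auto
  note Hc = orthonormal_matD[OF H]
  define B where "B = transpose_mat H * A * H"
  have Bc: "B \<in> carrier_mat ?N ?N" using Hc A by (simp add: B_def)
  have Bsym: "transpose_mat B = B"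
    using Hc A by (simp add: B_def transpose_mult[of _ ?N ?N _ ?N] assoc_mult_mat[of _ ?N ?N _ ?N _ ?N])
  have B_sym: "B $$ (i, j) = B $$ (j, i)" if "i < ?N" "j < ?N" for i j
    using that Bc arg_cong[OF Bsym, of "\<lambda>M. M $$ (j, i)"] by simp
  have AB: "A = H * B * transpose_mat H"
  proof -
    have "H * B * transpose_mat H = (H * transpose_mat H) * A * (H * transpose_mat H)"
      using Hc(1) A by (simp add: B_def assoc_mult_mat[of _ ?N ?N _ ?N _ ?N])
    then show ?thesis using Hc A by simp
  qed
  \<comment> \<open>The first column of \<open>H\<close> is the eigenvector \<open>v\<close>, so
    \<open>A\<close> maps it to \<open>k\<close> times itself, and orthonormality of the columns
    leaves only the top entry.\<close>
  have "B $$ (i, 0) = (if i = 0 then k else 0)" if i: "i < ?N" for i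
  proof -
    have "B $$ (i, 0) = col H i \<bullet> (A *\<^sub>v col H 0)"
    proof -
      have "B = transpose_mat H * (A * H)" using Hc A by (simp add: B_def)
      then show ?thesis using i Hc(1) A by (simp add: mult_mat_vec_def)
    qed
    also have "\<dots> = k * (col H i \<bullet> col H 0)" using Hv v i Hc by simp
    also have "col H i \<bullet> col H 0 = (transpose_mat H * H) $$ (i, 0)" using i Hc(1) by simp
    finally show ?thesis using i Hc by simp
  qed
  then have B0: "B $$ (0, 0) = k" "\<And>i. i < n \<Longrightarrow> B $$ (Suc i, 0) = 0" "\<And>i. i < n \<Longrightarrow> B $$ (0, Suc i) = 0"
    using B_sym[of 0] by auto
  define A' where "A' = mat n n (\<lambda>(i, j). B $$ (Suc i, Suc j))"
  have "sym_mat n A'" unfolding sym_mat_def A'_def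
    by (auto intro!: eq_matI simp: B_sym)
  from Suc.IH[OF this] obtain Q a where Q: "orthonormal_mat n Q" and A'Q: "A' = spectral_mat n Q a" by blast
  note Qc = orthonormal_matD[OF Q]
  \<comment> \<open>\<open>F\<close> is the block matrix with corner 1 and lower block
    \<open>Q\<close>; correspondingly \<open>case_nat k a\<close> puts \<open>k\<close> in front of
    the eigenvalues of \<open>A'\<close>.\<close>
  define F where "F = mat ?N ?N (\<lambda>(i, j). case (i, j) of (0, 0) \<Rightarrow> 1 | (Suc i, Suc j) \<Rightarrow> Q $$ (i, j) | _ \<Rightarrow> 0)"
  have F: "F \<in> carrier_mat ?N ?N" by (simp add: F_def)
  have Fi: "F $$ (0, 0) = 1" "\<And>i. i < n \<Longrightarrow> F $$ (Suc i, 0) = 0" "\<And>i. i < n \<Longrightarrow> F $$ (0, Suc i) = 0"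
    "\<And>i j. i < n \<Longrightarrow> j < n \<Longrightarrow> F $$ (Suc i, Suc j) = Q $$ (i, j)"
    by (auto simp: F_def)
  have QQ: "(\<Sum>l<n. Q $$ (l, i) * Q $$ (l, j)) = (if i = j then 1 else 0)" if "i < n" "j < n" for i j
    using arg_cong[OF Qc(2), of "\<lambda>M. M $$ (i, j)"] that Qc(1)
    by (simp add: scalar_prod_def lessThan_atLeast0)
  have FF: "transpose_mat F * F = 1\<^sub>m ?N"
  proof (rule eq_matI)
    fix i j assume "i < dim_row (1\<^sub>m ?N :: real mat)" "j < dim_col (1\<^sub>m ?N :: real mat)"
    then have ij: "i < ?N" "j < ?N" by auto
    have "(transpose_mat F * F) $$ (i, j) = (\<Sum>l<?N. F $$ (l, i) * F $$ (l, j))"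
      using F ij by (simp add: scalar_prod_def lessThan_atLeast0)
    then show "(transpose_mat F * F) $$ (i, j) = (1\<^sub>m ?N :: real mat) $$ (i, j)"
      unfolding sum.lessThan_Suc_shift using ij
      by (cases i; cases j) (auto simp: Fi QQ)
  qed (use F in auto)
  have BF: "B = spectral_mat ?N F (case_nat k a)"
  proof (rule eq_matI)
    fix i j assume "i < dim_row (spectral_mat ?N F (case_nat k a))" "j < dim_col (spectral_mat ?N F (case_nat k a))"
    then have ij: "i < ?N" "j < ?N" using F by (auto simp: spectral_mat_def)
    have A'i: "B $$ (Suc i, Suc j) = (\<Sum>l<n. Q $$ (i, l) * a l * Q $$ (j, l))" if "i < n" "j < n" for i j
      using that Qc(1) by (simp add: spectral_mat_index[symmetric] A'Q[symmetric], simp add: A'_def)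
    show "B $$ (i, j) = spectral_mat ?N F (case_nat k a) $$ (i, j)"
      unfolding spectral_mat_index[OF F ij] sum.lessThan_Suc_shift using ij
      by (cases i; cases j) (auto simp: Fi B0 A'i)
  qed (use F Bc in \<open>auto simp: spectral_mat_def\<close>)
  have "orthonormal_mat ?N (H * F)"
  proof -
    have "transpose_mat (H * F) * (H * F) = transpose_mat F * (transpose_mat H * H) * F"
      using Hc(1) F by (simp add: transpose_mult[of _ ?N ?N _ ?N] assoc_mult_mat[of _ ?N ?N _ ?N _ ?N])
    then show ?thesis using Hc F FF by (simp add: orthonormal_mat_def)
  qed
  moreover have "A = spectral_mat ?N (H * F) (case_nat k a)"
    unfolding AB BF spectral_mat_def using Hc(1) F
    by (simp add: transpose_mult[of _ ?N ?N _ ?N] assoc_mult_mat[of _ ?N ?N _ ?N _ ?N])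
  ultimately show ?case by blast
qed

section \<open>Trace, arithmetic and quadratic forms of diagonalised matrices\<close>

lemma mtrace_mult_commute:
  assumes "A \<in> carrier_mat n n" "B \<in> carrier_mat n n"
  shows "mtrace (A * B) = mtrace (B * A)"
proof -
  have "mtrace (A * B) = (\<Sum>i<n. \<Sum>k<n. A $$ (i, k) * B $$ (k, i))"
    using assms by (simp add: mtrace_def scalar_prod_def lessThan_atLeast0)
  also have "\<dots> = (\<Sum>k<n. \<Sum>i<n. B $$ (k, i) * A $$ (i, k))"
    by (subst sum.swap) (simp add: mult.commute)
  also have "\<dots> = mtrace (B * A)"
    using assms by (simp add: mtrace_def scalar_prod_def lessThan_atLeast0)
  finally show ?thesis .
qed

lemma mtrace_smult: "mtrace (k \<cdot>\<^sub>m A) = k * mtrace A" if "A \<in> carrier_mat n n"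
  using that by (simp add: mtrace_def sum_distrib_left)

lemma mtrace_add:
  assumes "A \<in> carrier_mat n n" "B \<in> carrier_mat n n"
  shows "mtrace (A + B) = mtrace A + mtrace B"
  using assms by (simp add: mtrace_def sum.distrib)

lemma mtrace_diff:
  assumes "A \<in> carrier_mat n n" "B \<in> carrier_mat n n"
  shows "mtrace (A - B) = mtrace A - mtrace B"
  using assms by (simp add: mtrace_def sum_subtractf)

lemma mtrace_mult_diff:
  assumes "A \<in> carrier_mat n n" "B \<in> carrier_mat n n" "C \<in> carrier_mat n n"
  shows "mtrace (A * (B - C)) = mtrace (A * B) - mtrace (A * C)"
  using assms by (simp add: mult_minus_distrib_mat[of _ n n] mtrace_diff[of _ n])

lemma mtrace_mult_smult:
  assumes "A \<in> carrier_mat n n" "B \<in> carrier_mat n n"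
  shows "mtrace (A * (k \<cdot>\<^sub>m B)) = k * mtrace (A * B)"
  using assms by (simp add: mult_smult_distrib[of _ n n] mtrace_smult[of _ n])

lemma orthonormal_mat_col:
  assumes "orthonormal_mat n P" "i < n" "j < n"
  shows "col P i \<bullet> col P j = (if i = j then 1 else 0)"
  using arg_cong[OF orthonormal_matD(2)[OF assms(1)], of "\<lambda>M. M $$ (i, j)"]
    orthonormal_matD(1)[OF assms(1)] assms by simp

lemma spectral_mat_col:
  assumes P: "orthonormal_mat n P" and i: "i < n"
  shows "spectral_mat n P a *\<^sub>v col P i = a i \<cdot>\<^sub>v col P i"
proof -
  note Pc = orthonormal_matD[OF P]
  have "spectral_mat n P a * P = P * mat_diag n a"
    using Pc by (simp add: spectral_mat_def right_mult_one_mat[of _ n n] assoc_mult_mat[of _ n n _ n _ n])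
  then have "spectral_mat n P a *\<^sub>v col P i = col (P * mat_diag n a) i"
    using Pc(1) i by (metis col_mult2 spectral_mat_carrier)
  also have "\<dots> = a i \<cdot>\<^sub>v col P i"
    using Pc(1) i by (intro eq_vecI) (auto simp: mat_diag_mult_right[of P n n])
  finally show ?thesis .
qed

lemma spectral_mat_sym: "P \<in> carrier_mat n n \<Longrightarrow> sym_mat n (spectral_mat n P a)"
  unfolding sym_mat_def
  by (auto intro!: eq_matI sum.cong simp: spectral_mat_index)

lemma spectral_mat_arith:
  assumes P: "P \<in> carrier_mat n n"
  shows "spectral_mat n P a + spectral_mat n P b = spectral_mat n P (\<lambda>i. a i + b i)"
    and "spectral_mat n P a - spectral_mat n P b = spectral_mat n P (\<lambda>i. a i - b i)"
    and "k \<cdot>\<^sub>m spectral_mat n P a = spectral_mat n P (\<lambda>i. k * a i)"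
proof -
  show "spectral_mat n P a + spectral_mat n P b = spectral_mat n P (\<lambda>i. a i + b i)"
    using P by (intro eq_matI) (simp_all add: spectral_mat_index[OF P] distrib_left distrib_right sum.distrib)
  show "spectral_mat n P a - spectral_mat n P b = spectral_mat n P (\<lambda>i. a i - b i)"
    using P by (intro eq_matI)
      (simp_all add: spectral_mat_index[OF P] left_diff_distrib right_diff_distrib sum_subtractf)
  show "k \<cdot>\<^sub>m spectral_mat n P a = spectral_mat n P (\<lambda>i. k * a i)"
    using P by (intro eq_matI) (simp_all add: spectral_mat_index[OF P] sum_distrib_left ac_simps)
qed

lemma spectral_mat_mult:
  assumes "orthonormal_mat n P"
  shows "spectral_mat n P a * spectral_mat n P b = spectral_mat n P (\<lambda>i. a i * b i)"
proof -
  note Pc = orthonormal_matD[OF assms]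
  have "spectral_mat n P a * spectral_mat n P b
      = P * mat_diag n a * (transpose_mat P * P) * (mat_diag n b * transpose_mat P)"
    using Pc(1) by (simp add: spectral_mat_def assoc_mult_mat[of _ n n _ n _ n])
  also have "\<dots> = P * (mat_diag n a * mat_diag n b) * transpose_mat P"
    using Pc by (simp add: left_mult_one_mat[of _ n n] assoc_mult_mat[of _ n n _ n _ n] del: mat_diag_diag)
  finally show ?thesis by (simp add: spectral_mat_def)
qed

lemma spectral_mat_one: "orthonormal_mat n P \<Longrightarrow> spectral_mat n P (\<lambda>_. 1) = 1\<^sub>m n"
  using orthonormal_matD[of n P] by (simp add: spectral_mat_def)

lemma quadratic_form_spectral_mat:
  assumes Q: "Q \<in> carrier_mat n n" and x: "x \<in> carrier_vec n"
  shows "x \<bullet> (spectral_mat n Q b *\<^sub>v x) = (\<Sum>j<n. b j * (col Q j \<bullet> x)\<^sup>2)"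
proof -
  define y where "y = transpose_mat Q *\<^sub>v x"
  have y: "y \<in> carrier_vec n" "\<And>j. j < n \<Longrightarrow> y $ j = col Q j \<bullet> x"
    using Q x by (auto simp: y_def)
  have Dy: "mat_diag n b *\<^sub>v y = vec n (\<lambda>j. b j * y $ j)"
  proof (rule eq_vecI)
    fix i assume "i < dim_vec (vec n (\<lambda>j. b j * y $ j))"
    then have i: "i < n" by simp
    have "(mat_diag n b *\<^sub>v y) $ i = (\<Sum>k<n. (if i = k then b k else 0) * y $ k)"
      using i y by (simp add: mat_diag_def scalar_prod_def lessThan_atLeast0)
    also have "\<dots> = (\<Sum>k<n. if i = k then b k * y $ k else 0)" by (rule sum.cong) auto
    finally show "(mat_diag n b *\<^sub>v y) $ i = vec n (\<lambda>j. b j * y $ j) $ i" using i by simp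
  qed (simp add: mat_diag_def)
  have "x \<bullet> (spectral_mat n Q b *\<^sub>v x) = x \<bullet> (Q *\<^sub>v (mat_diag n b *\<^sub>v y))"
    using Q x by (simp add: spectral_mat_def y_def assoc_mult_mat_vec[of _ n n _ n])
  also have "\<dots> = y \<bullet> (mat_diag n b *\<^sub>v y)"
    unfolding y_def using transpose_vec_mult_scalar[OF Q _ x] Q x
    by (metis mat_diag_dim mult_mat_vec_carrier transpose_carrier_mat)
  also have "\<dots> = (\<Sum>j<n. b j * (y $ j)\<^sup>2)"
    unfolding Dy using y(1) by (simp add: scalar_prod_def lessThan_atLeast0 power2_eq_square algebra_simps)
  finally show ?thesis using y(2) by simp
qed

lemma parseval:
  assumes Q: "orthonormal_mat n Q" and x: "x \<in> carrier_vec n"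
  shows "x \<bullet> x = (\<Sum>j<n. (col Q j \<bullet> x)\<^sup>2)"
  using quadratic_form_spectral_mat[OF orthonormal_matD(1)[OF Q] x, of "\<lambda>_. 1"] x
  by (simp add: spectral_mat_one[OF Q])

text \<open>Cyclicity of the trace moves \<open>P\<close> to the right, so only the diagonal of
  \<open>M\<close> in the basis \<open>P\<close> enters. This turns trace inequalities between
  noncommuting matrices into inequalities between weighted sums of scalars.\<close>

lemma mtrace_spectral_mat_mult:
  assumes P: "orthonormal_mat n P" and M: "M \<in> carrier_mat n n"
  shows "mtrace (spectral_mat n P a * M) = (\<Sum>i<n. a i * (col P i \<bullet> (M *\<^sub>v col P i)))"
proof -
  note Pc = orthonormal_matD[OF P]
  have "mtrace (spectral_mat n P a * M) = mtrace (P * (mat_diag n a * (transpose_mat P * M)))"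
    using Pc(1) M by (simp add: spectral_mat_def assoc_mult_mat[of _ n n _ n _ n])
  also have "\<dots> = mtrace (mat_diag n a * (transpose_mat P * (M * P)))"
    using Pc(1) M by (subst mtrace_mult_commute[of _ n]) (auto simp: assoc_mult_mat[of _ n n _ n _ n])
  also have "\<dots> = (\<Sum>i<n. a i * (col P i \<bullet> (M *\<^sub>v col P i)))"
    using Pc(1) M by (subst mat_diag_mult_left[of _ n n]) (auto simp: mtrace_def mult_mat_vec_def)
  finally show ?thesis .
qed

lemma mtrace_spectral_mat:
  assumes P: "orthonormal_mat n P"
  shows "mtrace (spectral_mat n P a) = (\<Sum>i<n. a i)"
proof -
  have "mtrace (spectral_mat n P a) = mtrace (spectral_mat n P a * 1\<^sub>m n)"
    using orthonormal_matD(1)[OF P] by (metis right_mult_one_mat spectral_mat_carrier)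
  also have "\<dots> = (\<Sum>i<n. a i)"
    unfolding mtrace_spectral_mat_mult[OF P one_carrier_mat]
    using orthonormal_matD(1)[OF P] by (auto simp: orthonormal_mat_col[OF P] intro!: sum.cong)
  finally show ?thesis .
qed

text \<open>The weights of the eigenvalues are quadratic forms of \<open>M\<close> at the columns of
  \<open>P\<close>, hence nonnegative, whether or not \<open>M\<close> commutes with the two
  spectral matrices.\<close>

lemma mtrace_spectral_mat_mono:
  assumes "orthonormal_mat n P" "psd_mat n M" "\<And>i. i < n \<Longrightarrow> a i \<le> b i"
  shows "mtrace (spectral_mat n P a * M) \<le> mtrace (spectral_mat n P b * M)"
proof -
  have M: "M \<in> carrier_mat n n" using assms(2) by (simp add: psd_mat_def sym_mat_def)
  have "col P i \<bullet> (M *\<^sub>v col P i) \<ge> 0" if "i < n" for i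
    using assms(2) that orthonormal_matD(1)[OF assms(1)] by (simp add: psd_mat_def)
  then show ?thesis
    unfolding mtrace_spectral_mat_mult[OF assms(1) M]
    using assms(3) by (intro sum_mono mult_right_mono) auto
qed

section \<open>Functional calculus, and positivity read off the eigenvalues\<close>

text \<open>\<open>mat_fun\<close> picks an arbitrary diagonalisation \<open>(Q, b)\<close>, and its
  value must not depend on that choice. The change of basis \<open>W\<close> intertwines the two
  diagonals, so \<open>W $$ (i, j)\<close> vanishes unless \<open>a j = b i\<close>; hence it also
  intertwines their images under \<open>f\<close>.\<close>

lemma mat_fun_spectral_mat:
  assumes P: "orthonormal_mat n P"
  shows "mat_fun n f (spectral_mat n P a) = spectral_mat n P (\<lambda>i. f (a i))"
proof -
  let ?A = "spectral_mat n P a"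
  let ?good = "\<lambda>p. orthonormal_mat n (fst p) \<and> ?A = fst p * mat_diag n (snd p) * transpose_mat (fst p)"
  define p where "p = (SOME p. ?good p)"
  define Q where "Q = fst p"
  define b where "b = snd p"
  have "?good (P, a)" using P by (simp add: spectral_mat_def)
  then have "?good p" unfolding p_def by (rule someI)
  then have Q: "orthonormal_mat n Q" and eq: "?A = spectral_mat n Q b"
    by (auto simp: Q_def b_def spectral_mat_def)
  note Pc = orthonormal_matD[OF P] and Qc = orthonormal_matD[OF Q]
  define W where "W = transpose_mat Q * P"
  have W: "W \<in> carrier_mat n n" using Pc Qc by (simp add: W_def)
  have "W * mat_diag n a = transpose_mat Q * (?A * P)"
    using Pc Qc(1) by (simp add: W_def spectral_mat_def right_mult_one_mat[of _ n n] assoc_mult_mat[of _ n n _ n _ n])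
  also have "\<dots> = (transpose_mat Q * Q) * (mat_diag n b * W)"
    unfolding eq using Pc(1) Qc(1) by (simp add: W_def spectral_mat_def assoc_mult_mat[of _ n n _ n _ n])
  also have "\<dots> = mat_diag n b * W" using Qc W by (simp add: left_mult_one_mat[of _ n n])
  finally have comm: "W * mat_diag n a = mat_diag n b * W" .
  have fW: "W * mat_diag n (\<lambda>i. f (a i)) = mat_diag n (\<lambda>i. f (b i)) * W"
  proof (rule eq_matI)
    fix i j assume "i < dim_row (mat_diag n (\<lambda>i. f (b i)) * W)" "j < dim_col (mat_diag n (\<lambda>i. f (b i)) * W)"
    then have ij: "i < n" "j < n" using W by (auto simp: mat_diag_def)
    have "W $$ (i, j) * a j = b i * W $$ (i, j)"
      using arg_cong[OF comm, of "\<lambda>M. M $$ (i, j)"] ij W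
      by (simp add: mat_diag_mult_left[of _ n n] mat_diag_mult_right[of _ n n])
    then have "W $$ (i, j) = 0 \<or> a j = b i" by auto
    then show "(W * mat_diag n (\<lambda>i. f (a i))) $$ (i, j) = (mat_diag n (\<lambda>i. f (b i)) * W) $$ (i, j)"
      using ij W by (auto simp: mat_diag_mult_left[of _ n n] mat_diag_mult_right[of _ n n])
  qed (use W in \<open>auto simp: mat_diag_def\<close>)
  have "spectral_mat n P (\<lambda>i. f (a i)) = (Q * transpose_mat Q) * spectral_mat n P (\<lambda>i. f (a i))"
    using Qc Pc by simp
  also have "\<dots> = Q * ((W * mat_diag n (\<lambda>i. f (a i))) * transpose_mat P)"
    using Pc(1) Qc(1) by (simp add: W_def spectral_mat_def assoc_mult_mat[of _ n n _ n _ n])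
  also have "\<dots> = Q * mat_diag n (\<lambda>i. f (b i)) * transpose_mat Q * (P * transpose_mat P)"
    unfolding fW using Pc(1) Qc(1) by (simp add: W_def assoc_mult_mat[of _ n n _ n _ n])
  also have "\<dots> = spectral_mat n Q (\<lambda>i. f (b i))"
    using Pc Qc(1) by (simp add: spectral_mat_def right_mult_one_mat[of _ n n] assoc_mult_mat[of _ n n _ n _ n])
  finally show ?thesis
    unfolding mat_fun_def Let_def p_def[symmetric] by (simp add: Q_def b_def spectral_mat_def)
qed

lemma quadratic_form_spectral_mat_col:
  assumes "orthonormal_mat n P" "i < n"
  shows "col P i \<bullet> (spectral_mat n P a *\<^sub>v col P i) = a i"
  using assms orthonormal_matD(1)[OF assms(1)]
  by (simp add: spectral_mat_col orthonormal_mat_col)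

lemma psd_spectral_mat_iff:
  assumes P: "orthonormal_mat n P"
  shows "psd_mat n (spectral_mat n P a) \<longleftrightarrow> (\<forall>i<n. 0 \<le> a i)"
proof
  assume psd: "psd_mat n (spectral_mat n P a)"
  show "\<forall>i<n. 0 \<le> a i"
  proof (intro allI impI)
    fix i assume i: "i < n"
    have "0 \<le> col P i \<bullet> (spectral_mat n P a *\<^sub>v col P i)"
      using psd i orthonormal_matD(1)[OF P] unfolding psd_mat_def by (meson carrier_matD(1) col_carrier_vec)
    then show "0 \<le> a i" by (simp add: quadratic_form_spectral_mat_col[OF P i])
  qed
next
  assume "\<forall>i<n. 0 \<le> a i"
  then show "psd_mat n (spectral_mat n P a)"
    unfolding psd_mat_def using orthonormal_matD(1)[OF P]
    by (auto simp: spectral_mat_sym quadratic_form_spectral_mat intro!: sum_nonneg)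
qed

text \<open>Strictness comes from Parseval: a nonzero vector has a nonzero coordinate along some
  column of \<open>P\<close>, and that term of the quadratic form is strictly positive.\<close>

lemma pd_spectral_mat_iff:
  assumes P: "orthonormal_mat n P"
  shows "pd_mat n (spectral_mat n P a) \<longleftrightarrow> (\<forall>i<n. 0 < a i)"
proof
  assume pd: "pd_mat n (spectral_mat n P a)"
  show "\<forall>i<n. 0 < a i"
  proof (intro allI impI)
    fix i assume i: "i < n"
    have "col P i \<bullet> col P i = 1" by (simp add: orthonormal_mat_col[OF P i i])
    moreover have c: "col P i \<in> carrier_vec n" using i orthonormal_matD(1)[OF P] by auto
    ultimately have "col P i \<noteq> 0\<^sub>v n" by auto
    then have "0 < col P i \<bullet> (spectral_mat n P a *\<^sub>v col P i)"
      using pd c unfolding pd_mat_def by blast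
    then show "0 < a i" by (simp add: quadratic_form_spectral_mat_col[OF P i])
  qed
next
  assume a: "\<forall>i<n. 0 < a i"
  have "0 < x \<bullet> (spectral_mat n P a *\<^sub>v x)" if x: "x \<in> carrier_vec n" "x \<noteq> 0\<^sub>v n" for x
  proof -
    have "x \<bullet> x \<noteq> 0"
    proof
      assume "x \<bullet> x = 0"
      then have "(\<Sum>k<n. x $ k * x $ k) = 0"
        using x(1) by (simp add: scalar_prod_def lessThan_atLeast0)
      then have "x $ k = 0" if "k < n" for k
        using that by (subst (asm) sum_nonneg_eq_0_iff) auto
      then have "x = 0\<^sub>v n" using x(1) by (intro eq_vecI) auto
      with x(2) show False by simp
    qed
    then have nz: "(\<Sum>j<n. (col P j \<bullet> x)\<^sup>2) \<noteq> 0" unfolding parseval[OF P x(1)] .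
    have "\<exists>j<n. col P j \<bullet> x \<noteq> 0"
    proof (rule ccontr)
      assume "\<not> (\<exists>j<n. col P j \<bullet> x \<noteq> 0)"
      then have "(\<Sum>j<n. (col P j \<bullet> x)\<^sup>2) = 0" by (intro sum.neutral) auto
      with nz show False by blast
    qed
    then obtain j where j: "j < n" "col P j \<bullet> x \<noteq> 0" by blast
    have "0 < (\<Sum>j<n. a j * (col P j \<bullet> x)\<^sup>2)"
      using a j by (intro sum_pos2[of _ j]) (simp_all add: less_imp_le)
    then show ?thesis using quadratic_form_spectral_mat[OF orthonormal_matD(1)[OF P] x(1)] by simp
  qed
  then show "pd_mat n (spectral_mat n P a)"
    unfolding pd_mat_def using spectral_mat_sym[OF orthonormal_matD(1)[OF P]] by blast
qed

lemma psd_mat_spectral: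
  assumes "psd_mat n A"
  obtains P a where "orthonormal_mat n P" "A = spectral_mat n P a" "\<And>i. i < n \<Longrightarrow> 0 \<le> a i"
proof -
  obtain P a where P: "orthonormal_mat n P" "A = spectral_mat n P a"
    using spectral_theorem[of n A] assms unfolding psd_mat_def by blast
  moreover have "\<forall>i<n. 0 \<le> a i"
    using assms unfolding P(2) psd_spectral_mat_iff[OF P(1)] .
  ultimately show ?thesis using that by blast
qed

lemma mtrace_psd_mult_nonneg:
  assumes "psd_mat n A" "psd_mat n B"
  shows "0 \<le> mtrace (A * B)"
proof -
  obtain P a where P: "orthonormal_mat n P" "A = spectral_mat n P a" "\<And>i. i < n \<Longrightarrow> 0 \<le> a i"
    using psd_mat_spectral[OF assms(1)] by blast
  have B: "B \<in> carrier_mat n n" using assms by (simp add: psd_mat_def sym_mat_def)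
  show ?thesis
    unfolding P(2) mtrace_spectral_mat_mult[OF P(1) B] using P(3) assms(2) orthonormal_matD(1)[OF P(1)]
    by (auto intro!: sum_nonneg simp: psd_mat_def)
qed

lemma mexp_spectral:
  assumes "sym_mat n A"
  obtains P a where "orthonormal_mat n P" "A = spectral_mat n P a"
    "mexp n A = spectral_mat n P (\<lambda>i. exp (a i))"
proof -
  obtain P a where "orthonormal_mat n P" "A = spectral_mat n P a"
    using spectral_theorem[OF assms] by blast
  then show ?thesis using that mat_fun_spectral_mat[of n P exp a] by (simp add: mexp_def)
qed

section \<open>Convexity of the exponential and trace inequalities of Klein type\<close>

text \<open>The trapezoidal rule overestimates the integral of the convex function
  \<open>exp\<close>. In the proof \<open>f\<close> is the case \<open>y = 0\<close>: it vanishes at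
  0 and has the derivative \<open>(1 - (1 - t) * exp t) / 2\<close>, which is nonnegative because
  \<open>1 - t <= exp (- t)\<close>. Multiplying by \<open>exp y\<close> gives the general
  case.\<close>

lemma exp_diff_le_mean:
  assumes "y \<le> (x :: real)"
  shows "exp x - exp y \<le> (x - y) * (exp x + exp y) / 2"
proof -
  define f where "f t = t * (exp t + 1) / 2 - exp t + 1" for t :: real
  have "\<exists>d. (f has_real_derivative d) (at t) \<and> 0 \<le> d" for t
  proof -
    have "1 - t \<le> exp (- t)" using exp_ge_add_one_self[of "- t"] by simp
    then have "(1 - t) * exp t \<le> exp (- t) * exp t" by (rule mult_right_mono) simp
    also have "\<dots> = 1" by (simp flip: exp_add)
    finally have "0 \<le> ((exp t + 1) + t * exp t) / 2 - exp t" by (simp add: algebra_simps)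
    moreover have "(f has_real_derivative ((exp t + 1) + t * exp t) / 2 - exp t) (at t)"
      unfolding f_def by (auto intro!: derivative_eq_intros)
    ultimately show ?thesis by blast
  qed
  then have "f 0 \<le> f (x - y)"
    using assms by (intro DERIV_nonneg_imp_nondecreasing[of 0 "x - y" f]) auto
  then have "0 \<le> exp y * f (x - y)" by (simp add: f_def)
  also have "exp y * f (x - y) = (x - y) * (exp x + exp y) / 2 - exp x + exp y"
    by (simp add: f_def exp_diff field_simps)
  finally show ?thesis by simp
qed

lemma exp_diff_mult_le:
  fixes x y :: real
  shows "(exp x - exp y) * (x - y) \<le> (exp x + exp y) / 2 * (x - y)\<^sup>2"
proof -
  have *: "(exp x - exp y) * (x - y) \<le> (exp x + exp y) / 2 * (x - y)\<^sup>2" if "y \<le> x" for x y :: real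
  proof -
    have "(exp x - exp y) * (x - y) \<le> (x - y) * (exp x + exp y) / 2 * (x - y)"
      using mult_right_mono[OF exp_diff_le_mean[OF that], of "x - y"] that by simp
    then show ?thesis by (simp add: power2_eq_square mult.commute mult.left_commute)
  qed
  show ?thesis
    using *[of y x] *[of x y] by (cases "y \<le> x") (auto simp: power2_commute[of x y] algebra_simps)
qed

text \<open>With \<open>p = col P i\<close> and \<open>q = col Q j\<close>, the vector
  \<open>D p\<close> has the coordinate \<open>(q . p) * (b i - c j)\<close> along \<open>q\<close>,
  and the form of \<open>D * D\<close> is its squared length since \<open>D\<close> is symmetric.
  The squared overlaps sum to 1 over \<open>j\<close>, so the two sums are the mean and the second
  moment of \<open>b i - c j\<close>.\<close>

lemma quadratic_form_diff_spectral:
  fixes b c :: "nat \<Rightarrow> real"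
  assumes P: "orthonormal_mat n P" and Q: "orthonormal_mat n Q" and i: "i < n"
  defines "D \<equiv> spectral_mat n P b - spectral_mat n Q c"
  shows "col P i \<bullet> (D *\<^sub>v col P i) = (\<Sum>j<n. (col Q j \<bullet> col P i)\<^sup>2 * (b i - c j))"
    and "col P i \<bullet> ((D * D) *\<^sub>v col P i) = (\<Sum>j<n. (col Q j \<bullet> col P i)\<^sup>2 * (b i - c j)\<^sup>2)"
proof -
  let ?p = "col P i"
  let ?B = "spectral_mat n P b" and ?C = "spectral_mat n Q c"
  note Pc = orthonormal_matD(1)[OF P] and Qc = orthonormal_matD(1)[OF Q]
  have p: "?p \<in> carrier_vec n" "?p \<bullet> ?p = 1" using Pc i by (auto simp: orthonormal_mat_col[OF P])
  have sum1: "(\<Sum>j<n. (col Q j \<bullet> ?p)\<^sup>2) = 1" using parseval[OF Q p(1)] p(2) by simp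
  have Dc: "D \<in> carrier_mat n n" using Pc Qc unfolding D_def by (simp add: minus_carrier_mat)
  have Dsym: "transpose_mat D = D"
    using spectral_mat_sym[OF Pc, of b] spectral_mat_sym[OF Qc, of c] unfolding D_def
    by (simp add: sym_mat_def transpose_minus[of _ n n])
  have Dp: "D *\<^sub>v ?p = b i \<cdot>\<^sub>v ?p - ?C *\<^sub>v ?p"
    unfolding D_def using Pc Qc p by (simp add: minus_mult_distrib_mat_vec[of _ n n] spectral_mat_col[OF P i])
  have Cp: "?C *\<^sub>v ?p \<in> carrier_vec n" using Qc p by (meson mult_mat_vec_carrier spectral_mat_carrier)
  have "?p \<bullet> (D *\<^sub>v ?p) = b i * (\<Sum>j<n. (col Q j \<bullet> ?p)\<^sup>2) - (\<Sum>j<n. c j * (col Q j \<bullet> ?p)\<^sup>2)"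
    unfolding Dp sum1 quadratic_form_spectral_mat[OF Qc p(1), symmetric]
    using p Cp by (simp add: scalar_prod_minus_distrib[of _ n])
  also have "\<dots> = (\<Sum>j<n. (col Q j \<bullet> ?p)\<^sup>2 * (b i - c j))"
    by (simp add: sum_distrib_left sum_subtractf[symmetric] algebra_simps)
  finally show "?p \<bullet> (D *\<^sub>v ?p) = (\<Sum>j<n. (col Q j \<bullet> ?p)\<^sup>2 * (b i - c j))" .
  have Dpc: "D *\<^sub>v ?p \<in> carrier_vec n" using Dc p by (meson mult_mat_vec_carrier)
  have q: "col Q j \<bullet> (D *\<^sub>v ?p) = (col Q j \<bullet> ?p) * (b i - c j)" if j: "j < n" for j
  proof -
    have qc: "col Q j \<in> carrier_vec n" using Qc j by simp
    have "col Q j \<bullet> (?C *\<^sub>v ?p) = (?C *\<^sub>v col Q j) \<bullet> ?p"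
      using transpose_vec_mult_scalar[OF spectral_mat_carrier[OF Qc] p(1) qc, of c]
        spectral_mat_sym[OF Qc, of c] by (simp add: sym_mat_def)
    also have "\<dots> = c j * (col Q j \<bullet> ?p)"
      using qc p by (simp add: spectral_mat_col[OF Q j])
    finally show ?thesis
      unfolding Dp using qc p Cp by (simp add: scalar_prod_minus_distrib[of _ n] algebra_simps)
  qed
  have "?p \<bullet> ((D * D) *\<^sub>v ?p) = ?p \<bullet> (D *\<^sub>v (D *\<^sub>v ?p))"
    using Dc p by (simp add: assoc_mult_mat_vec[of _ n n _ n])
  also have "\<dots> = (D *\<^sub>v ?p) \<bullet> (D *\<^sub>v ?p)"
    using transpose_vec_mult_scalar[OF Dc Dpc p(1)] Dsym by simp
  also have "\<dots> = (\<Sum>j<n. (col Q j \<bullet> ?p)\<^sup>2 * (b i - c j)\<^sup>2)"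
    unfolding parseval[OF Q Dpc] by (auto simp: q power_mult_distrib)
  finally show "?p \<bullet> ((D * D) *\<^sub>v ?p) = (\<Sum>j<n. (col Q j \<bullet> ?p)\<^sup>2 * (b i - c j)\<^sup>2)" .
qed

text \<open>The squared overlaps \<open>w i j\<close> of the two eigenbases form a doubly stochastic
  matrix. All traces become double sums over these same nonnegative weights, and both inequalities
  can be checked for each pair \<open>b i\<close>, \<open>c j\<close> separately.\<close>

lemma mtrace_mexp_diff:
  assumes B: "sym_mat n B" and C: "sym_mat n C"
  shows "mtrace (mexp n B) - mtrace (mexp n C) \<le> mtrace (mexp n B * (B - C))"
    and "mtrace (mexp n B * (B - C)) - mtrace (mexp n C * (B - C))
      \<le> (mtrace (mexp n B * ((B - C) * (B - C))) + mtrace (mexp n C * ((B - C) * (B - C)))) / 2"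
proof -
  obtain P b where P: "orthonormal_mat n P" "B = spectral_mat n P b"
    "mexp n B = spectral_mat n P (\<lambda>i. exp (b i))" using mexp_spectral[OF B] .
  obtain Q c where Q: "orthonormal_mat n Q" "C = spectral_mat n Q c"
    "mexp n C = spectral_mat n Q (\<lambda>i. exp (c i))" using mexp_spectral[OF C] .
  note Pc = orthonormal_matD(1)[OF P(1)] and Qc = orthonormal_matD(1)[OF Q(1)]
  have Bc: "B \<in> carrier_mat n n" and Cc: "C \<in> carrier_mat n n" using B C by (auto simp: sym_mat_def)
  define w where "w i j = (col P i \<bullet> col Q j)\<^sup>2" for i j
  have w': "(col Q j \<bullet> col P i)\<^sup>2 = w i j" if "i < n" "j < n" for i j
    using that Pc Qc comm_scalar_prod[of "col P i" n "col Q j"] by (simp add: w_def)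
  have w0: "w i j \<ge> 0" for i j by (simp add: w_def)
  have w1: "(\<Sum>j<n. w i j) = 1" if "i < n" for i
    using parseval[OF Q(1), of "col P i"] that Pc w' orthonormal_mat_col[OF P(1) that that] by simp
  have w2: "(\<Sum>i<n. w i j) = 1" if "j < n" for j
    using parseval[OF P(1), of "col Q j"] that Qc orthonormal_mat_col[OF Q(1) that that] by (simp add: w_def)
  have DD: "(C - B) * (C - B) = (B - C) * (B - C)"
    using Bc Cc by (intro eq_matI) (auto simp: scalar_prod_def algebra_simps intro!: sum.cong)
  have tB: "mtrace (mexp n B * (B - C)) = (\<Sum>i<n. \<Sum>j<n. w i j * (exp (b i) * (b i - c j)))"
    "mtrace (mexp n B * ((B - C) * (B - C))) = (\<Sum>i<n. \<Sum>j<n. w i j * (exp (b i) * (b i - c j)\<^sup>2))"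
    unfolding P(3)
    by (subst mtrace_spectral_mat_mult[OF P(1)];
        use Bc Cc P(2) Q(2) in \<open>auto simp: minus_carrier_mat quadratic_form_diff_spectral[OF P(1) Q(1)] w' sum_distrib_left
        mult.left_commute intro!: sum.cong\<close>)+
  have "mtrace (mexp n C * (C - B)) = (\<Sum>j<n. \<Sum>i<n. w i j * (exp (c j) * (c j - b i)))"
    unfolding Q(3)
    by (subst mtrace_spectral_mat_mult[OF Q(1)];
        use Bc Cc P(2) Q(2) in \<open>auto simp: minus_carrier_mat quadratic_form_diff_spectral[OF Q(1) P(1)] w_def sum_distrib_left
        mult.left_commute intro!: sum.cong\<close>)+
  moreover have "mtrace (mexp n C * (B - C)) = - mtrace (mexp n C * (C - B))"
    using Q(3) Qc Bc Cc by (simp add: mtrace_mult_diff[of _ n])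
  ultimately have tC1: "mtrace (mexp n C * (B - C)) = (\<Sum>i<n. \<Sum>j<n. w i j * (exp (c j) * (b i - c j)))"
    by (simp add: sum_negf[symmetric] algebra_simps) (rule sum.swap)
  have "mtrace (mexp n C * ((C - B) * (C - B))) = (\<Sum>j<n. \<Sum>i<n. w i j * (exp (c j) * (c j - b i)\<^sup>2))"
    unfolding Q(3)
    by (subst mtrace_spectral_mat_mult[OF Q(1)];
        use Bc Cc P(2) Q(2) in \<open>auto simp: minus_carrier_mat quadratic_form_diff_spectral[OF Q(1) P(1)] w_def sum_distrib_left
        mult.left_commute intro!: sum.cong\<close>)+
  then have tC2: "mtrace (mexp n C * ((B - C) * (B - C))) = (\<Sum>i<n. \<Sum>j<n. w i j * (exp (c j) * (b i - c j)\<^sup>2))"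
    unfolding DD by (simp add: power2_commute[of "c _"]) (rule sum.swap)
  \<comment> \<open>Row sums 1 insert the weights into the trace of \<open>mexp n B\<close>, column
    sums 1 into that of \<open>mexp n C\<close>.\<close>
  have tr: "mtrace (mexp n B) = (\<Sum>i<n. \<Sum>j<n. w i j * exp (b i))"
    "mtrace (mexp n C) = (\<Sum>i<n. \<Sum>j<n. w i j * exp (c j))"
    using w1 w2 by (simp_all add: P(3) Q(3) mtrace_spectral_mat[OF P(1)] mtrace_spectral_mat[OF Q(1)]
        sum_distrib_right[symmetric] sum.swap[of "\<lambda>i j. w i j * exp (c j)"])
  show "mtrace (mexp n B) - mtrace (mexp n C) \<le> mtrace (mexp n B * (B - C))"
    unfolding tr tB sum_subtractf[symmetric] right_diff_distrib[symmetric]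
  proof (intro sum_mono mult_left_mono w0)
    fix i j
    \<comment> \<open>The tangent to \<open>exp\<close> at \<open>b i\<close>, evaluated at
      \<open>c j\<close>.\<close>
    have "exp (b i) * (1 + (c j - b i)) \<le> exp (b i) * exp (c j - b i)"
      by (intro mult_left_mono exp_ge_add_one_self) auto
    then show "exp (b i) - exp (c j) \<le> exp (b i) * (b i - c j)"
      by (simp add: exp_diff algebra_simps)
  qed
  have "mtrace (mexp n B * (B - C)) - mtrace (mexp n C * (B - C))
    = (\<Sum>i<n. \<Sum>j<n. w i j * ((exp (b i) - exp (c j)) * (b i - c j)))"
    unfolding tB tC1 sum_subtractf[symmetric] by (intro sum.cong refl) (simp add: algebra_simps)
  also have "\<dots> \<le> (\<Sum>i<n. \<Sum>j<n. w i j * ((exp (b i) + exp (c j)) / 2 * (b i - c j)\<^sup>2))"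
    by (intro sum_mono mult_left_mono w0 exp_diff_mult_le)
  also have "\<dots> = (mtrace (mexp n B * ((B - C) * (B - C))) + mtrace (mexp n C * ((B - C) * (B - C)))) / 2"
    unfolding tB tC2 sum.distrib[symmetric] sum_divide_distrib
    by (intro sum.cong refl) (simp add: field_simps)
  finally show "mtrace (mexp n B * (B - C)) - mtrace (mexp n C * (B - C))
      \<le> (mtrace (mexp n B * ((B - C) * (B - C))) + mtrace (mexp n C * ((B - C) * (B - C)))) / 2" .
qed

section \<open>Decrease of \<open>Tr exp (H - d C)\<close> for \<open>C\<close> between 0 and the
  identity\<close>

lemma spectral_mat_const: "orthonormal_mat n P \<Longrightarrow> spectral_mat n P (\<lambda>_. k) = k \<cdot>\<^sub>m 1\<^sub>m n"
  using spectral_mat_arith(3)[OF orthonormal_matD(1), of n P k "\<lambda>_. 1"] by (simp add: spectral_mat_one)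

text \<open>The eigenvalues of \<open>C\<close> lie in \<open>[0, 1]\<close>, where squaring does
  not increase. This lets the second order error be charged to the loss itself.\<close>

lemma mtrace_mult_contraction_square_le:
  assumes E: "psd_mat n E" and C: "psd_mat n C" "psd_mat n (1\<^sub>m n - C)"
  shows "mtrace (E * (C * C)) \<le> mtrace (E * C)"
proof -
  obtain R c where R: "orthonormal_mat n R" "C = spectral_mat n R c" and c0: "\<And>i. i < n \<Longrightarrow> 0 \<le> c i"
    using psd_mat_spectral[OF C(1)] by blast
  have "1\<^sub>m n - C = spectral_mat n R (\<lambda>i. 1 - c i)"
    unfolding R(2) spectral_mat_one[OF R(1), symmetric] spectral_mat_arith(2)[OF orthonormal_matD(1)[OF R(1)]] ..
  then have c1: "c i \<le> 1" if "i < n" for i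
    using C(2) that psd_spectral_mat_iff[OF R(1)] by simp
  have Ec: "E \<in> carrier_mat n n" and Cc: "C \<in> carrier_mat n n"
    using E C(1) by (auto simp: psd_mat_def sym_mat_def)
  have "mtrace (C * C * E) \<le> mtrace (C * E)"
    unfolding R(2) spectral_mat_mult[OF R(1)]
    by (rule mtrace_spectral_mat_mono[OF R(1) E]) (use c0 c1 in \<open>auto intro: mult_left_le\<close>)
  then show ?thesis using Ec Cc by (simp add: mtrace_mult_commute[of E n])
qed

lemma sym_mat_diff_smult:
  assumes "sym_mat n A" "sym_mat n B"
  shows "sym_mat n (A - k \<cdot>\<^sub>m B)"
proof -
  have "transpose_mat (k \<cdot>\<^sub>m B) = k \<cdot>\<^sub>m transpose_mat B" by (intro eq_matI) auto
  then show ?thesis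
    using assms by (simp add: sym_mat_def transpose_minus[of _ n n] minus_carrier_mat)
qed

lemma psd_mexp: "sym_mat n A \<Longrightarrow> psd_mat n (mexp n A)"
  by (erule mexp_spectral) (simp add: psd_spectral_mat_iff)

text \<open>Let \<open>G = H - d C\<close>. The first Klein inequality, for the pair
  \<open>(G, H)\<close>, measures the loss at the endpoint \<open>G\<close>. The second, for
  \<open>(H, G)\<close>, carries it back to \<open>H\<close>: its right side is at most
  \<open>d^2 * (h + g) / 2\<close>, where \<open>h\<close> and \<open>g\<close> are the losses at
  \<open>H\<close> and \<open>G\<close>, and one factor \<open>d\<close> cancels.\<close>

lemma mtrace_mexp_decrease:
  assumes H: "sym_mat n H" and C: "psd_mat n C" "psd_mat n (1\<^sub>m n - C)"
  shows "d * mtrace (mexp n (H - d \<cdot>\<^sub>m C) * C) \<le> mtrace (mexp n H) - mtrace (mexp n (H - d \<cdot>\<^sub>m C))"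
    and "0 < d \<Longrightarrow> (2 - d) * mtrace (mexp n H * C) \<le> (2 + d) * mtrace (mexp n (H - d \<cdot>\<^sub>m C) * C)"
proof -
  define G where "G = H - d \<cdot>\<^sub>m C"
  have Hc: "H \<in> carrier_mat n n" and Cc: "C \<in> carrier_mat n n"
    using H C(1) by (auto simp: psd_mat_def sym_mat_def)
  have G: "sym_mat n G"
    using H C(1) by (simp add: G_def psd_mat_def sym_mat_diff_smult)
  have EH: "mexp n H \<in> carrier_mat n n" and EG: "mexp n G \<in> carrier_mat n n"
    using psd_mexp[OF H] psd_mexp[OF G] by (auto simp: psd_mat_def sym_mat_def)
  have GH: "G - H = (- d) \<cdot>\<^sub>m C" using Hc Cc by (intro eq_matI) (auto simp: G_def)
  have HG: "H - G = d \<cdot>\<^sub>m C" using Hc Cc by (intro eq_matI) (auto simp: G_def)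
  show "d * mtrace (mexp n (H - d \<cdot>\<^sub>m C) * C) \<le> mtrace (mexp n H) - mtrace (mexp n (H - d \<cdot>\<^sub>m C))"
    using mtrace_mexp_diff(1)[OF G H] unfolding GH G_def[symmetric] by (simp add: mtrace_mult_smult[OF EG Cc])
  assume d: "0 < d"
  have sq: "(d \<cdot>\<^sub>m C) * (d \<cdot>\<^sub>m C) = d\<^sup>2 \<cdot>\<^sub>m (C * C)"
    using Cc by (simp add: mult_smult_distrib[of _ n n _ n] mult_smult_assoc_mat[of _ n n _ n])
      (intro eq_matI, auto simp: power2_eq_square)
  have CC: "C * C \<in> carrier_mat n n" using Cc by simp
  let ?h = "mtrace (mexp n H * C)" and ?g = "mtrace (mexp n G * C)"
  have "d * (?h - ?g) \<le> d\<^sup>2 * ((mtrace (mexp n H * (C * C)) + mtrace (mexp n G * (C * C))) / 2)"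
    using mtrace_mexp_diff(2)[OF H G] unfolding HG sq
    by (simp add: mtrace_mult_smult[OF EG Cc] mtrace_mult_smult[OF EH Cc]
        mtrace_mult_smult[OF EG CC] mtrace_mult_smult[OF EH CC] algebra_simps)
  also have "\<dots> \<le> d\<^sup>2 * ((?h + ?g) / 2)"
    using mtrace_mult_contraction_square_le[OF psd_mexp[OF H] C]
      mtrace_mult_contraction_square_le[OF psd_mexp[OF G] C]
    by (intro mult_left_mono divide_right_mono add_mono) auto
  finally have "d * (?h - ?g) \<le> d * (d * ((?h + ?g) / 2))" by (simp add: power2_eq_square)
  then have "?h - ?g \<le> d * ((?h + ?g) / 2)" using d by simp
  then show "(2 - d) * ?h \<le> (2 + d) * mtrace (mexp n (H - d \<cdot>\<^sub>m C) * C)"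
    unfolding G_def[symmetric] by (simp add: field_simps)
qed

text \<open>
  For \<open>d > 1\<close> the rate is the value at \<open>d = 1\<close>: beyond that point it only matters that
  \<open>Tr exp (H - d C)\<close> does not increase.
\<close>

definition loss_rate :: "real \<Rightarrow> real" where
  "loss_rate d = (if d \<le> 1 then d * (2 - d) / (2 + d) else 1 / 3)"

text \<open>The local fact \<open>small\<close> chains the two preceding estimates. For
  \<open>d > 1\<close> the path is cut at 1: the first leg supplies the rate \<open>1 / 3\<close>,
  the second has length \<open>d - 1\<close> and does not raise the trace.\<close>

lemma mtrace_mexp_loss:
  assumes H: "sym_mat n H" and C: "psd_mat n C" "psd_mat n (1\<^sub>m n - C)" and d: "0 < d"
  shows "mtrace (mexp n (H - d \<cdot>\<^sub>m C)) \<le> mtrace (mexp n H) - loss_rate d * mtrace (mexp n H * C)"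
proof -
  have small: "mtrace (mexp n (H - d \<cdot>\<^sub>m C)) \<le> mtrace (mexp n H) - d * (2 - d) / (2 + d) * mtrace (mexp n H * C)"
    if d: "0 < d" for d
  proof -
    have "(2 - d) / (2 + d) * mtrace (mexp n H * C) \<le> mtrace (mexp n (H - d \<cdot>\<^sub>m C) * C)"
      using mtrace_mexp_decrease(2)[OF H C d] d by (simp add: field_simps)
    then have "d * ((2 - d) / (2 + d) * mtrace (mexp n H * C)) \<le> d * mtrace (mexp n (H - d \<cdot>\<^sub>m C) * C)"
      using d by (intro mult_left_mono) auto
    then show ?thesis using mtrace_mexp_decrease(1)[OF H C, of d] by simp
  qed
  show ?thesis
  proof (cases "d \<le> 1")
    case True
    then show ?thesis using small[OF d] by (simp add: loss_rate_def)
  next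
    case False
    let ?G = "H - 1 \<cdot>\<^sub>m C"
    have Hc: "H \<in> carrier_mat n n" and Cc: "C \<in> carrier_mat n n"
      using H C(1) by (auto simp: psd_mat_def sym_mat_def)
    have symd: "sym_mat n (H - k \<cdot>\<^sub>m C)" for k
      using H C(1) by (simp add: psd_mat_def sym_mat_diff_smult)
    have eq: "?G - (d - 1) \<cdot>\<^sub>m C = H - d \<cdot>\<^sub>m C"
      using Hc Cc by (intro eq_matI) (auto simp: algebra_simps)
    have "0 \<le> (d - 1) * mtrace (mexp n (H - d \<cdot>\<^sub>m C) * C)"
      using False mtrace_psd_mult_nonneg[OF psd_mexp[OF symd] C(1)] by simp
    then have "mtrace (mexp n (H - d \<cdot>\<^sub>m C)) \<le> mtrace (mexp n ?G)"
      using mtrace_mexp_decrease(1)[OF symd[of 1] C, of "d - 1"] unfolding eq by simp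
    then show ?thesis using small[of 1] False by (simp add: loss_rate_def)
  qed
qed

section \<open>One round of the algorithm, seen through \<open>Tr (U ln Y)\<close>\<close>

text \<open>The trace of a 0 by 0 matrix is an empty sum, hence not 1. The theorem quantifies over
  every \<open>n\<close>, and this excludes \<open>n = 0\<close>.\<close>

lemma density_mat_dim_pos: "U \<in> density_mats n \<Longrightarrow> 0 < n"
  by (cases n) (auto simp: density_mats_def psd_mat_def sym_mat_def mtrace_def)

text \<open>\<open>U\<close> acts as an expectation: being positive semidefinite it respects the
  order of the eigenvalues, and having trace 1 it turns a uniform shift by \<open>k\<close> into a
  shift by exactly \<open>k\<close>.\<close>

lemma density_mat_trace_mono:
  assumes U: "U \<in> density_mats n" and P: "orthonormal_mat n P"
    and le: "\<And>i. i < n \<Longrightarrow> x i \<le> y i + k"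
  shows "mtrace (U * spectral_mat n P x) \<le> mtrace (U * spectral_mat n P y) + k"
proof -
  have Uc: "U \<in> carrier_mat n n" and psd: "psd_mat n U" and tr: "mtrace U = 1"
    using U by (auto simp: density_mats_def psd_mat_def sym_mat_def)
  note Pc = orthonormal_matD(1)[OF P]
  have "mtrace (U * spectral_mat n P x) \<le> mtrace (U * spectral_mat n P (\<lambda>i. y i + k))"
    using mtrace_spectral_mat_mono[OF P psd le] Uc Pc by (simp add: mtrace_mult_commute[of U n])
  also have "U * spectral_mat n P (\<lambda>i. y i + k) = U * spectral_mat n P y + k \<cdot>\<^sub>m U"
    using spectral_mat_arith(1)[OF Pc, of y "\<lambda>_. k"] Uc Pc
    by (simp add: spectral_mat_const[OF P] flip: spectral_mat_arith(1)[OF Pc, of y "\<lambda>_. k"])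
      (simp add: mult_add_distrib_mat[of _ n n _ n] mult_smult_distrib[of _ n n _ n] right_mult_one_mat[of _ n n])
  also have "mtrace (U * spectral_mat n P y + k \<cdot>\<^sub>m U) = mtrace (U * spectral_mat n P y) + k"
    using Uc Pc tr by (simp add: mtrace_add[of _ n] mtrace_smult[of _ n])
  finally show ?thesis .
qed

lemma density_mat_trace_bounds:
  assumes U: "U \<in> density_mats n" and P: "orthonormal_mat n P"
  shows "(\<And>i. i < n \<Longrightarrow> x i \<le> k) \<Longrightarrow> mtrace (U * spectral_mat n P x) \<le> k"
    and "(\<And>i. i < n \<Longrightarrow> k \<le> x i) \<Longrightarrow> k \<le> mtrace (U * spectral_mat n P x)"
proof -
  have Uc: "U \<in> carrier_mat n n" using U by (auto simp: density_mats_def psd_mat_def sym_mat_def)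
  have z: "mtrace (U * spectral_mat n P (\<lambda>_. 0)) = 0"
    using Uc by (simp add: spectral_mat_const[OF P] mult_smult_distrib[of _ n n _ n] right_mult_one_mat[of _ n n] mtrace_smult[of _ n])
  show "mtrace (U * spectral_mat n P x) \<le> k" if "\<And>i. i < n \<Longrightarrow> x i \<le> k"
    using density_mat_trace_mono[OF U P, of x "\<lambda>_. 0" k] that z by simp
  show "k \<le> mtrace (U * spectral_mat n P x)" if "\<And>i. i < n \<Longrightarrow> k \<le> x i"
    using density_mat_trace_mono[OF U P, of "\<lambda>_. 0" x "- k"] that z by simp
qed

lemma mln_spectral_mat: "orthonormal_mat n P \<Longrightarrow> mln n (spectral_mat n P a) = spectral_mat n P (\<lambda>i. ln (a i))"
  by (simp add: mln_def mat_fun_spectral_mat)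

text \<open>Normalising only subtracts a multiple of the identity from the logarithm:
  \<open>ln V = ln Y - d C - ln Z\<close>, so the change of the potential is known exactly. Then
  \<open>ln Z <= Z - 1\<close> and \<open>mtrace_mexp_loss\<close> with \<open>Tr Y = 1\<close>
  bring in the loss of \<open>Y\<close>.\<close>

lemma exponentiated_gradient_step:
  assumes Y: "pd_mat n Y" "mtrace Y = 1"
    and C: "psd_mat n C" "psd_mat n (1\<^sub>m n - C)" and d: "0 < d" and n: "0 < n"
  defines "E \<equiv> mexp n (mln n Y - d \<cdot>\<^sub>m C)"
  defines "V \<equiv> (1 / mtrace E) \<cdot>\<^sub>m E"
  shows "pd_mat n V" "mtrace V = 1"
    and "U \<in> density_mats n \<Longrightarrow> loss_rate d * mtrace (Y * C)
      \<le> d * mtrace (U * C) + mtrace (U * mln n V) - mtrace (U * mln n Y)"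
proof -
  have "sym_mat n Y" using Y by (simp add: pd_mat_def)
  then obtain P y where P: "orthonormal_mat n P" "Y = spectral_mat n P y"
    using spectral_theorem by blast
  note Pc = orthonormal_matD(1)[OF P(1)]
  have y: "0 < y i" if "i < n" for i
    using that Y P by (simp add: pd_spectral_mat_iff)
  have lnY: "mln n Y = spectral_mat n P (\<lambda>i. ln (y i))" using P by (simp add: mln_spectral_mat)
  have H: "sym_mat n (mln n Y)" using Pc by (simp add: lnY spectral_mat_sym)
  \<comment> \<open>This relies on positive eigenvalues, since \<open>exp\<close> inverts the real
    \<open>ln\<close> only at positive arguments.\<close>
  have "mexp n (mln n Y) = spectral_mat n P (\<lambda>i. exp (ln (y i)))"
    unfolding lnY mexp_def by (simp add: mat_fun_spectral_mat[OF P(1)])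
  also have "\<dots> = Y" unfolding P(2) using Pc y
    by (intro eq_matI) (auto simp: spectral_mat_index intro!: sum.cong)
  finally have expln: "mexp n (mln n Y) = Y" .
  define B where "B = mln n Y - d \<cdot>\<^sub>m C"
  have Cc: "C \<in> carrier_mat n n" using C(1) by (simp add: psd_mat_def sym_mat_def)
  have Hc: "mln n Y \<in> carrier_mat n n" using H by (simp add: sym_mat_def)
  have "sym_mat n B"
    using H C(1) by (simp add: B_def psd_mat_def sym_mat_diff_smult)
  then obtain Q b where Q: "orthonormal_mat n Q" "B = spectral_mat n Q b"
    "mexp n B = spectral_mat n Q (\<lambda>i. exp (b i))" by (rule mexp_spectral)
  note Qc = orthonormal_matD(1)[OF Q(1)]
  define Z where "Z = mtrace E"
  have E: "E = spectral_mat n Q (\<lambda>i. exp (b i))" by (simp add: E_def Q(3)[symmetric] B_def)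
  have Z: "Z = (\<Sum>i<n. exp (b i))" by (simp add: Z_def E mtrace_spectral_mat[OF Q(1)])
  have Zpos: "0 < Z" unfolding Z using n by (intro sum_pos) auto
  have V: "V = spectral_mat n Q (\<lambda>i. 1 / Z * exp (b i))"
    using spectral_mat_arith(3)[OF Qc, of "1 / Z"] E by (simp add: V_def Z_def)
  show "pd_mat n V" using Zpos by (simp add: V pd_spectral_mat_iff[OF Q(1)])
  have Ec: "E \<in> carrier_mat n n" using Qc by (simp add: E)
  show "mtrace V = 1" using Zpos by (simp add: V_def mtrace_smult[OF Ec] Z_def)
  assume U: "U \<in> density_mats n"
  have Uc: "U \<in> carrier_mat n n" and tr: "mtrace U = 1"
    using U by (auto simp: density_mats_def psd_mat_def sym_mat_def)
  have "mln n V = spectral_mat n Q (\<lambda>i. ln (1 / Z * exp (b i)))" by (simp add: V mln_spectral_mat[OF Q(1)])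
  also have "\<dots> = spectral_mat n Q (\<lambda>i. b i - ln Z)"
    using Zpos by (simp add: ln_mult ln_div)
  also have "\<dots> = B - ln Z \<cdot>\<^sub>m 1\<^sub>m n"
    unfolding Q(2) spectral_mat_const[OF Q(1), symmetric] spectral_mat_arith(2)[OF Qc] ..
  finally have "mln n V = B - ln Z \<cdot>\<^sub>m 1\<^sub>m n" .
  then have "mtrace (U * mln n V) = mtrace (U * B) - ln Z"
    using Uc Qc Q(2) by (simp add: mtrace_mult_diff[of _ n] mtrace_mult_smult[of _ n] tr)
  also have "mtrace (U * B) = mtrace (U * mln n Y) - d * mtrace (U * C)"
    unfolding B_def using Uc Hc Cc by (simp add: mtrace_mult_diff[of _ n] mtrace_mult_smult[of _ n])
  finally have eq: "mtrace (U * mln n V) = mtrace (U * mln n Y) - d * mtrace (U * C) - ln Z" .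
  have "ln Z \<le> Z - 1" using Zpos by (rule ln_le_minus_one)
  also have "Z \<le> 1 - loss_rate d * mtrace (Y * C)"
    using mtrace_mexp_loss[OF H C d] unfolding expln Z_def E_def Y(2) .
  finally show "loss_rate d * mtrace (Y * C) \<le> d * mtrace (U * C) + mtrace (U * mln n V) - mtrace (U * mln n Y)"
    using eq by simp
qed

text \<open>Mixing keeps the eigenbasis, and each new eigenvalue dominates both
  \<open>(1 - a) * v j\<close> and \<open>a / n\<close>. The first bound limits the cost in
  potential; the second keeps the logarithm from being too negative, which allows the analysis to
  start at any later round.\<close>

lemma mixing_step:
  assumes V: "pd_mat n V" "mtrace V = 1" and W: "orthonormal_mat n W" "V = spectral_mat n W v"
    and Y: "Y = spectral_mat n W (\<lambda>j. a / real n + (1 - a) * v j)"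
    and a: "0 < a" "a < 1" and n: "0 < n"
  shows "pd_mat n Y" "mtrace Y = 1"
    and "U \<in> density_mats n \<Longrightarrow> mtrace (U * mln n V) \<le> mtrace (U * mln n Y) - ln (1 - a)"
    and "U \<in> density_mats n \<Longrightarrow> ln (a / real n) \<le> mtrace (U * mln n Y)"
proof -
  have v: "0 < v j" if "j < n" for j
    using that V(1) by (simp add: W(2) pd_spectral_mat_iff[OF W(1)])
  have y: "0 < a / real n + (1 - a) * v j" "a / real n \<le> a / real n + (1 - a) * v j"
      "(1 - a) * v j \<le> a / real n + (1 - a) * v j" if "j < n" for j
    using v[OF that] a n by (auto intro!: add_pos_pos)
  show "pd_mat n Y" using y(1) by (simp add: Y pd_spectral_mat_iff[OF W(1)])
  have "(\<Sum>j<n. v j) = 1" using V(2) by (simp add: W(2) mtrace_spectral_mat[OF W(1)])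
  then show "mtrace Y = 1"
    using n by (simp add: Y mtrace_spectral_mat[OF W(1)] sum.distrib sum_distrib_left[symmetric])
  assume U: "U \<in> density_mats n"
  show "ln (a / real n) \<le> mtrace (U * mln n Y)"
    unfolding Y mln_spectral_mat[OF W(1)] using y a n
    by (intro density_mat_trace_bounds(2)[OF U W(1)] ln_mono) auto
  have "ln (v j) \<le> ln (a / real n + (1 - a) * v j) + - ln (1 - a)" if "j < n" for j
  proof -
    have "ln (1 - a) + ln (v j) = ln ((1 - a) * v j)" using v[OF that] a by (simp add: ln_mult)
    also have "\<dots> \<le> ln (a / real n + (1 - a) * v j)" using y[OF that] v[OF that] a by (intro ln_mono) auto
    finally show ?thesis by simp
  qed
  then show "mtrace (U * mln n V) \<le> mtrace (U * mln n Y) - ln (1 - a)"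
    unfolding Y W(2) mln_spectral_mat[OF W(1)]
    using density_mat_trace_mono[OF U W(1), of "\<lambda>j. ln (v j)" _ "- ln (1 - a)"] by simp
qed

text \<open>Positive eigenvalues with sum 1 are at most 1. This disposes of the last term of the
  telescoping sum.\<close>

lemma density_mat_mln_nonpos:
  assumes V: "pd_mat n V" "mtrace V = 1" and U: "U \<in> density_mats n"
  shows "mtrace (U * mln n V) \<le> 0"
proof -
  obtain W v where W: "orthonormal_mat n W" "V = spectral_mat n W v"
    using V spectral_theorem unfolding pd_mat_def by blast
  have v: "0 < v j" if "j < n" for j
    using that V(1) by (simp add: W(2) pd_spectral_mat_iff[OF W(1)])
  have s: "(\<Sum>j<n. v j) = 1" using V(2) by (simp add: W(2) mtrace_spectral_mat[OF W(1)])
  have "v j \<le> 1" if "j < n" for j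
    using member_le_sum[of j "{..<n}" v] that v s by (auto intro: less_imp_le)
  then show ?thesis
    unfolding W(2) mln_spectral_mat[OF W(1)] using v
    by (intro density_mat_trace_bounds(1)[OF U W(1)]) simp
qed

section \<open>From the potential bound to the regret on every interval\<close>

text \<open>\<open>S\<close> stands for the loss of the algorithm and \<open>L'\<close> for that of
  the best comparator. The choice of \<open>d\<close> balances \<open>d * L'\<close> against
  \<open>D / d\<close>: one has \<open>d * L' <= x * L = sqrt (2 * L * D)\<close> and
  \<open>D / d <= D / x + D\<close>, where \<open>D / x\<close> is half of that root.\<close>

lemma regret_of_potential_bound:
  fixes L D L' S d x :: real
  assumes L: "0 < L" and D: "0 < D" and L': "0 \<le> L'" "L' \<le> L"
    and x: "x = sqrt (2 * D / L)" and d: "d = ln (1 + x)"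
    and S: "loss_rate d * S \<le> d * L' + D"
  shows "S - L' \<le> 3 * (sqrt (2 * L * D) + D)"
proof -
  let ?s = "sqrt (2 * L * D)"
  have xpos: "0 < x" using L D by (simp add: x)
  have xL: "x * L = ?s"
    using L D by (simp add: x real_sqrt_divide real_sqrt_mult field_simps)
  have Dx: "D / x = ?s / 2"
    using L D by (simp add: x real_sqrt_divide real_sqrt_mult field_simps)
  have dpos: "0 < d" using xpos by (simp add: d)
  have dx: "d \<le> x" using xpos ln_add_one_self_le_self[of x] by (simp add: d)
  have dL: "d * L' \<le> ?s"
    unfolding xL[symmetric] using dx L' dpos L xpos by (intro mult_mono) auto
  show ?thesis
  proof (cases "d \<le> 1")
    case True
    \<comment> \<open>Applied to the reciprocal, the bound \<open>ln u <= u - 1\<close> estimates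
      \<open>d\<close> from below.\<close>
    have "ln (1 / (1 + x)) \<le> 1 / (1 + x) - 1" using xpos by (intro ln_le_minus_one) simp
    then have "x / (1 + x) \<le> d" using xpos by (simp add: d ln_div field_simps)
    then have "D / d \<le> D / (x / (1 + x))" using D xpos dpos by (intro divide_left_mono) auto
    also have "\<dots> = D / x + D" using xpos by (simp add: field_simps)
    finally have Dd: "D / d \<le> ?s / 2 + D" by (simp add: Dx)
    have "d * (2 - d) * S \<le> (d * L' + D) * (2 + d)"
      using S True dpos by (simp add: loss_rate_def field_simps)
    \<comment> \<open>For \<open>0 < d <= 1\<close> the inverse rate
      \<open>(2 + d) / (d * (2 - d))\<close> is at most \<open>(1 + 2 * d) / d\<close>; after
      clearing denominators the gap is \<open>2 * d * (1 - d)\<close>. The price beyond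
      \<open>L' + D / d\<close> is then \<open>2 * d * L' + 2 * D\<close>.\<close>
    also have "\<dots> \<le> (d * L' + D) * ((1 + 2 * d) * (2 - d))"
    proof (rule mult_left_mono)
      have "d * d \<le> d * 1" using True dpos by (intro mult_left_mono) auto
      then show "2 + d \<le> (1 + 2 * d) * (2 - d)" by (simp add: algebra_simps)
    qed (use D dpos L' in simp)
    finally have "(2 - d) * (d * S) \<le> (2 - d) * ((d * L' + D) * (1 + 2 * d))" by (simp add: algebra_simps)
    then have "d * S \<le> (d * L' + D) * (1 + 2 * d)" using True by simp
    then have "S \<le> (d * L' + D) * (1 + 2 * d) / d" using dpos by (simp add: field_simps)
    also have "\<dots> = L' + 2 * (d * L') + D / d + 2 * D" using dpos by (simp add: field_simps)
    finally have "S - L' \<le> 2 * ?s + (?s / 2 + D) + 2 * D" using dL Dd by linarith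
    moreover have "2 * q + (q / 2 + D) + 2 * D \<le> 3 * (q + D)" if "0 \<le> q" for q
      using that by simp
    ultimately show ?thesis using D L by (meson real_sqrt_ge_zero mult_nonneg_nonneg less_imp_le order_trans zero_le_numeral)
  next
    case False
    \<comment> \<open>The rate is now \<open>1 / 3\<close>, so \<open>S <= 3 * (d * L' + D)\<close>
      at once, and subtracting \<open>L' >= 0\<close> only helps.\<close>
    then show ?thesis using S dL L' by (simp add: loss_rate_def)
  qed
qed

theorem theorem4p4:
  "\<exists>c::real. \<forall>(n::nat) (T::nat) (C::nat \<Rightarrow> real mat) (Y::nat \<Rightarrow> real mat)
      (V::nat \<Rightarrow> real mat) (L::real).
    T \<ge> 1 \<longrightarrow>
    (\<forall>t\<in>{1..T}. sym_mat n (C t) \<and> psd_mat n (C t) \<and> psd_mat n (1\<^sub>m n - C t)) \<longrightarrow>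
    Y 1 \<in> density_mats n \<longrightarrow> pd_mat n (Y 1) \<longrightarrow>
    L > 0 \<longrightarrow>
    (\<forall>r s. 1 \<le> r \<longrightarrow> r \<le> s \<longrightarrow> s \<le> T \<longrightarrow>
       (INF U\<in>density_mats n. \<Sum>t=r..s. mtrace (U * C t)) \<le> L) \<longrightarrow>
    (let \<alpha> = 1 / (real T + 1);
         D = ln (real n * (1 + real T)) + 1;
         \<eta> = ln (1 + sqrt (2 * D / L))
     in
       (\<forall>t\<in>{1..<T}.
          V (t + 1) = (1 / mtrace (mexp n (mln n (Y t) - \<eta> \<cdot>\<^sub>m C t)))
                        \<cdot>\<^sub>m mexp n (mln n (Y t) - \<eta> \<cdot>\<^sub>m C t)
        \<and> (\<exists>Uh v. orthonormal_mat n Uh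
              \<and> V (t + 1) = Uh * mat_diag n v * transpose_mat Uh
              \<and> Y (t + 1) = Uh * mat_diag n (\<lambda>j. \<alpha> / real n + (1 - \<alpha>) * v j)
                              * transpose_mat Uh))
       \<longrightarrow>
       (\<forall>r s. 1 \<le> r \<longrightarrow> r \<le> s \<longrightarrow> s \<le> T \<longrightarrow>
          (\<Sum>t=r..s. mtrace (Y t * C t))
            - (INF U\<in>density_mats n. \<Sum>t=r..s. mtrace (U * C t))
          \<le> c * (sqrt (2 * L * D) + D)))"
proof (intro exI[of _ "4 :: real"] allI impI, unfold Let_def, intro allI impI)
  fix n T :: nat and C Y V :: "nat \<Rightarrow> real mat" and L :: real and r s :: nat
  assume T: "1 \<le> T"
    and C: "\<forall>t\<in>{1..T}. sym_mat n (C t) \<and> psd_mat n (C t) \<and> psd_mat n (1\<^sub>m n - C t)"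
    and Y1: "Y 1 \<in> density_mats n" "pd_mat n (Y 1)"
    and L: "0 < L"
    and INF_le: "\<forall>r s. 1 \<le> r \<longrightarrow> r \<le> s \<longrightarrow> s \<le> T \<longrightarrow>
       (INF U\<in>density_mats n. \<Sum>t=r..s. mtrace (U * C t)) \<le> L"
    and rs: "1 \<le> r" "r \<le> s" "s \<le> T"
  define a where "a = 1 / (real T + 1)"
  define D where "D = ln (real n * (1 + real T)) + 1"
  define d where "d = ln (1 + sqrt (2 * D / L))"
  assume "\<forall>t\<in>{1..<T}.
          V (t + 1) = (1 / mtrace (mexp n (mln n (Y t) - ln (1 + sqrt (2 * (ln (real n * (1 + real T)) + 1) / L)) \<cdot>\<^sub>m C t)))
                        \<cdot>\<^sub>m mexp n (mln n (Y t) - ln (1 + sqrt (2 * (ln (real n * (1 + real T)) + 1) / L)) \<cdot>\<^sub>m C t)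
        \<and> (\<exists>Uh v. orthonormal_mat n Uh
              \<and> V (t + 1) = Uh * mat_diag n v * transpose_mat Uh
              \<and> Y (t + 1) = Uh * mat_diag n (\<lambda>j. 1 / (real T + 1) / real n + (1 - 1 / (real T + 1)) * v j)
                              * transpose_mat Uh)"
  then have alg: "\<forall>t\<in>{1..<T}.
          V (t + 1) = (1 / mtrace (mexp n (mln n (Y t) - d \<cdot>\<^sub>m C t))) \<cdot>\<^sub>m mexp n (mln n (Y t) - d \<cdot>\<^sub>m C t)
        \<and> (\<exists>Uh v. orthonormal_mat n Uh \<and> V (t + 1) = spectral_mat n Uh v
              \<and> Y (t + 1) = spectral_mat n Uh (\<lambda>j. a / real n + (1 - a) * v j))"
    by (simp only: a_def D_def d_def spectral_mat_def)
  have n: "0 < n" using Y1(1) by (rule density_mat_dim_pos)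
  have a: "0 < a" "a < 1" using T by (auto simp: a_def)
  have "1 \<le> real n * (1 + real T)" using n mult_mono[of 1 "real n" 1 "1 + real T"] by simp
  then have D: "1 \<le> D" by (simp add: D_def)
  have "0 < sqrt (2 * D / L)" using D L by simp
  then have d: "0 < d" unfolding d_def by (intro ln_gt_zero) linarith
  have Ct: "psd_mat n (C t)" "psd_mat n (1\<^sub>m n - C t)" "C t \<in> carrier_mat n n" if "1 \<le> t" "t \<le> T" for t
    using C that by (auto simp: sym_mat_def)
  \<comment> \<open>\<open>W t\<close> equals \<open>V (t + 1)\<close> for \<open>t < T\<close>, but
    it is also meaningful at \<open>t = T\<close>, where the update hypothesis does not determine
    \<open>V (t + 1)\<close>. The telescoping sum ends there when \<open>s = T\<close>.\<close>
  define W where "W t = (1 / mtrace (mexp n (mln n (Y t) - d \<cdot>\<^sub>m C t))) \<cdot>\<^sub>m mexp n (mln n (Y t) - d \<cdot>\<^sub>m C t)" for t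
  have step: "pd_mat n (Y (Suc t))" "mtrace (Y (Suc t)) = 1"
      "\<And>U. U \<in> density_mats n \<Longrightarrow> mtrace (U * mln n (W t)) \<le> mtrace (U * mln n (Y (Suc t))) - ln (1 - a)"
      "\<And>U. U \<in> density_mats n \<Longrightarrow> ln (a / real n) \<le> mtrace (U * mln n (Y (Suc t)))"
    if t: "1 \<le> t" "t < T" and Yt: "pd_mat n (Y t)" "mtrace (Y t) = 1" for t
  proof -
    have "V (t + 1) = W t \<and> (\<exists>Uh v. orthonormal_mat n Uh \<and> V (t + 1) = spectral_mat n Uh v
        \<and> Y (t + 1) = spectral_mat n Uh (\<lambda>j. a / real n + (1 - a) * v j))"
      unfolding W_def by (rule bspec[OF alg]) (use t in simp)
    then obtain Uh v where Uh: "orthonormal_mat n Uh" "W t = spectral_mat n Uh v"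
      "Y (Suc t) = spectral_mat n Uh (\<lambda>j. a / real n + (1 - a) * v j)"
      unfolding Suc_eq_plus1 by metis
    have Wt: "pd_mat n (W t)" "mtrace (W t) = 1"
      unfolding W_def using exponentiated_gradient_step(1,2)[OF Yt Ct(1,2) d n] t by auto
    note mixing_step[OF Wt Uh a n]
    then show "pd_mat n (Y (Suc t))" "mtrace (Y (Suc t)) = 1"
      "\<And>U. U \<in> density_mats n \<Longrightarrow> mtrace (U * mln n (W t)) \<le> mtrace (U * mln n (Y (Suc t))) - ln (1 - a)"
      "\<And>U. U \<in> density_mats n \<Longrightarrow> ln (a / real n) \<le> mtrace (U * mln n (Y (Suc t)))" by blast+
  qed
  have Yt: "pd_mat n (Y t) \<and> mtrace (Y t) = 1" if "1 \<le> t" "t \<le> T" for t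
    using that
  proof (induction t rule: nat_induct_at_least)
    case base
    then show ?case using Y1 by (simp add: density_mats_def)
  next
    case (Suc t)
    then show ?case using step(1,2)[of t] by simp
  qed
  have mixed: "mtrace (U * mln n (W t)) \<le> mtrace (U * mln n (Y (Suc t))) - ln (1 - a)"
    if "1 \<le> t" "t < T" "U \<in> density_mats n" for t U
    using step(3)[of t U] Yt[of t] that by simp
  have loss: "loss_rate d * mtrace (Y t * C t)
      \<le> d * mtrace (U * C t) + mtrace (U * mln n (W t)) - mtrace (U * mln n (Y t))"
    if "1 \<le> t" "t \<le> T" "U \<in> density_mats n" for t U
    unfolding W_def using exponentiated_gradient_step(3)[OF _ _ Ct(1,2) d n] Yt that by blast
  have UC: "0 \<le> mtrace (U * C t)" if "U \<in> density_mats n" "1 \<le> t" "t \<le> T" for U t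
    using that Ct mtrace_psd_mult_nonneg by (auto simp: density_mats_def)
  have Wle: "mtrace (U * mln n (W t)) \<le> 0" if "U \<in> density_mats n" "1 \<le> t" "t \<le> T" for U t
    using density_mat_mln_nonpos[OF _ _ that(1)] exponentiated_gradient_step(1,2)[OF _ _ Ct(1,2) d n] Yt that
    by (auto simp: W_def)
  \<comment> \<open>\<open>Y 1\<close> is an arbitrary positive definite density matrix, so
    \<open>a / n\<close> need not bound its eigenvalues from below. The telescoping starts at round
    2 or later, and round 1 is paid for separately.\<close>
  define m where "m = max r 2"
  define e where "e = - ln (1 - a)"
  \<comment> \<open>With \<open>a = 1 / (T + 1)\<close> one has
    \<open>1 / (1 - a) = 1 + 1 / T\<close>, so \<open>T\<close> mixing steps cost at most 1 in
    total; this is the summand 1 in \<open>D\<close>.\<close>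
  have "e = ln (1 + 1 / real T)" using T by (simp add: e_def a_def field_simps flip: ln_inverse)
  also have "\<dots> \<le> 1 / real T" by (rule ln_add_one_self_le_self) simp
  finally have eT: "real T * e \<le> 1" using T by (simp add: field_simps)
  have e0: "0 \<le> e" using a by (simp add: e_def)
  have main: "loss_rate d * (\<Sum>t=m..s. mtrace (Y t * C t)) \<le> d * (\<Sum>t=r..s. mtrace (U * C t)) + D"
    if U: "U \<in> density_mats n" for U
  proof (cases "m \<le> s")
    \<comment> \<open>This happens only for \<open>r = s = 1\<close>, and the sum on the left is
      then empty.\<close>
    case False
    then show ?thesis
      using UC[OF U] rs d D by (auto intro!: add_nonneg_nonneg mult_nonneg_nonneg sum_nonneg)
  next
    case True
    have m: "1 \<le> m" "2 \<le> m" "r \<le> m" by (auto simp: m_def)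
    \<comment> \<open>The sum ends at \<open>W k\<close>, before the mixing of round
      \<open>k\<close>, so only \<open>k - m\<close> mixing steps are charged.\<close>
    have tele: "loss_rate d * (\<Sum>t=m..k. mtrace (Y t * C t))
        \<le> d * (\<Sum>t=m..k. mtrace (U * C t)) + mtrace (U * mln n (W k)) - mtrace (U * mln n (Y m)) + (real k - real m) * e"
      if "m \<le> k" "k \<le> T" for k
      using that
    proof (induction k rule: dec_induct)
      case base
      then show ?case using loss[of m U] m U by simp
    next
      case (step k)
      have "loss_rate d * (\<Sum>t=m..Suc k. mtrace (Y t * C t))
        = loss_rate d * (\<Sum>t=m..k. mtrace (Y t * C t)) + loss_rate d * mtrace (Y (Suc k) * C (Suc k))"
        using step by (simp add: distrib_left)
      also have "\<dots> \<le> (d * (\<Sum>t=m..k. mtrace (U * C t)) + mtrace (U * mln n (W k)) - mtrace (U * mln n (Y m)) + (real k - real m) * e)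
        + (d * mtrace (U * C (Suc k)) + mtrace (U * mln n (W (Suc k))) - mtrace (U * mln n (Y (Suc k))))"
        using step m U by (intro add_mono step.IH loss) auto
      also have "mtrace (U * mln n (W k)) \<le> mtrace (U * mln n (Y (Suc k))) + e"
        using mixed[of k] step.prems step.hyps m U by (simp add: e_def)
      finally show ?case using step by (simp add: algebra_simps)
    qed
    have "mtrace (U * mln n (W s)) \<le> 0" using Wle[OF U] rs by simp
    moreover have "- mtrace (U * mln n (Y m)) \<le> ln (real n * (1 + real T))"
    proof -
      \<comment> \<open>Because \<open>m >= 2\<close>, \<open>Y m\<close> is the outcome of the
        mixing in round \<open>m - 1\<close>.\<close>
      have "ln (a / real n) \<le> mtrace (U * mln n (Y (Suc (m - 1))))"
        using m True rs Yt[of "m - 1"] U by (intro step(4)) auto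
      moreover have "ln (a / real n) = - ln (real n * (1 + real T))"
        using n by (simp add: a_def ln_div ln_mult add.commute)
      ultimately show ?thesis using m by simp
    qed
    moreover have "(real s - real m) * e \<le> real T * e" using rs e0 by (intro mult_right_mono) auto
    \<comment> \<open>Comparator losses are nonnegative, so the sum may be extended to include round
      1.\<close>
    moreover have "(\<Sum>t=m..s. mtrace (U * C t)) \<le> (\<Sum>t=r..s. mtrace (U * C t))"
      using UC[OF U] rs m by (intro sum_mono2) auto
    then have "d * (\<Sum>t=m..s. mtrace (U * C t)) \<le> d * (\<Sum>t=r..s. mtrace (U * C t))"
      using d by (intro mult_left_mono) auto
    ultimately show ?thesis using tele[OF True] rs eT by (simp add: D_def)
  qed
  define L' where "L' = (INF U\<in>density_mats n. \<Sum>t=r..s. mtrace (U * C t))"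
  have ne: "density_mats n \<noteq> {}" using Y1 by blast
  define S where "S = (\<Sum>t=m..s. mtrace (Y t * C t))"
  \<comment> \<open>Solved for the comparator loss, \<open>main\<close> is a lower bound valid for
    every \<open>U\<close>, and as such it passes to the infimum.\<close>
  have "(loss_rate d * S - D) / d \<le> L'"
    unfolding L'_def using main d by (intro cINF_greatest[OF ne]) (simp add: S_def field_simps)
  then have "loss_rate d * S \<le> d * L' + D" using d by (simp add: field_simps)
  moreover have "0 \<le> L'" unfolding L'_def using UC rs
    by (intro cINF_greatest[OF ne] sum_nonneg) auto
  moreover have "L' \<le> L" using INF_le rs by (simp add: L'_def)
  ultimately have SL: "S - L' \<le> 3 * (sqrt (2 * L * D) + D)"
    using L D d_def by (intro regret_of_potential_bound[of L D L' _ d]) auto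
  have "(\<Sum>t=r..s. mtrace (Y t * C t)) \<le> S + 1"
  proof (cases "r = 1")
    case False
    then have "m = r" using rs by (simp add: m_def)
    then show ?thesis by (simp add: S_def)
  next
    case True
    have "mtrace (Y 1 * C 1) \<le> 1"
    proof -
      have c: "Y 1 \<in> carrier_mat n n" "C 1 \<in> carrier_mat n n" "mtrace (Y 1) = 1"
        using Y1 Ct(3)[of 1] T by (auto simp: density_mats_def psd_mat_def sym_mat_def)
      have "0 \<le> mtrace (Y 1 * (1\<^sub>m n - C 1))"
        using Y1 Ct(2)[of 1] T by (intro mtrace_psd_mult_nonneg) (auto simp: density_mats_def)
      then show ?thesis using c by (simp add: mtrace_mult_diff[of _ n])
    qed
    moreover have "(\<Sum>t=1..s. mtrace (Y t * C t)) = mtrace (Y 1 * C 1) + (\<Sum>t=2..s. mtrace (Y t * C t))"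
      using rs True by (subst sum.atLeast_Suc_atMost) (auto simp: numeral_2_eq_2)
    moreover have "m = 2" using True by (simp add: m_def)
    ultimately show ?thesis unfolding S_def True by simp
  qed
  \<comment> \<open>The additive 1 for the first round is absorbed by \<open>1 <= D\<close>, which
    raises the constant from 3 to 4.\<close>
  then have "(\<Sum>t=r..s. mtrace (Y t * C t)) - L' \<le> 3 * (sqrt (2 * L * D) + D) + D" using SL D by linarith
  moreover have "3 * (q + D) + D \<le> 4 * (q + D)" if "0 \<le> q" for q using that by simp
  moreover have "0 \<le> sqrt (2 * L * D)" using L D by simp
  ultimately show "(\<Sum>t=r..s. mtrace (Y t * C t)) - (INF U\<in>density_mats n. \<Sum>t=r..s. mtrace (U * C t))
      \<le> 4 * (sqrt (2 * L * (ln (real n * (1 + real T)) + 1)) + (ln (real n * (1 + real T)) + 1))"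
    unfolding L'_def[symmetric] D_def[symmetric] by (meson order_trans)
qed

end
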